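(* Let $(X,(\gamma_t)_{t\ge 0},\mathrm{obs})$ be a Feller-Dynkin process and let $x,y\in X$ be two states. If $x$ and $y$ are bisimilar in the sense of Chen, Clerc and Panangaden (that is, related by some bisimulation equivalence relation on $X$), then $x$ and $y$ are behaviourally equivalent in the corresponding $\mathsf{Samp}_{\mathbb{R}_{\ge0}}$-graded coalgebra $(X,\hat\gamma)$.
   Context: Let $\mathcal{G}_{\le}$ be the subprobability measure monad on the category $\mathbf{Meas}$ of measurable spaces. Feller-Dynkin process: a family of transition kernels $\gamma_t\colon X\to\mathcal{G}_{\le}(X)$ ($t\in\mathbb{R}_{\ge0}$) with $\gamma_0(x)$ the Dirac measure at $x$ and $\gamma_{s+t}(x)(C)=\int\gamma_t(z)(C)\,\gamma_s(x)(dz)$, together with a measurable map $\mathrm{obs}\colon X\to B:=2^A$, where $A$ is a finite set (of atomic propositions) and $B$ is discrete. In addition, the state space is topological (with its Borel $\sigma$-algebra) and the kernels satisfy the Feller-Dynkin continuity conditions, which ensure that the process can be realised with cadlag (right-continuous with left limits) trajectories. No further use of these conditions is made in the statement, beyond the existence of the path laws below. Path laws: missing mass is sent to an absorbing point $\partial$ adjoined to $X$; a trajectory is a cadlag map $\omega\colon\mathbb{R}_{\ge0}\to X\cup\{\partial\}$ that stays at $\partial$ once it reaches it; the $\sigma$-algebra on trajectories is generated by the evaluations $\omega\mapsto\omega(t)$; $P^x$ denotes the law on trajectories of the Markov process with transition kernels $(\gamma_t)_t$ started at $x$. Bisimulation: an equivalence relation $R$ on $X$ (extended to $X\cup\{\partial\}$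 by relating $\partial$ only to itself) such that, whenever $x\mathrel{R}y$: (i) $\mathrm{obs}(x)=\mathrm{obs}(y)$; and (ii) $P^x(U)=P^y(U)$ for every measurable set $U$ of trajectories that is time-$R$-closed, meaning that if $\omega\in U$ and $\omega(t)\mathrel{R}\omega'(t)$ for all $t\ge0$ then $\omega'\in U$. States $x,y$ are bisimilar if $x\mathrel{R}y$ for some bisimulation $R$. Sampling monoid: $\mathsf{Samp}_{\mathbb{R}_{\ge0}}$ is the coproduct (free product) of the monoids $(\mathbb{R}_{\ge0},+,0)$ and $(\mathbb{N},+,0)$; its elements are lists $w=(t_0,k_0,\dots,t_n,k_n)$ with $t_i\in\mathbb{R}_{\ge0}$, $k_i\in\mathbb{N}$, $t_i\ne0$ for $i\ge1$ and $k_i>0$ for $i<n$; its unit is $(0,0)$. Write $k(w)=k_0+\dots+k_n$. Graded monad: $N_w=\mathcal{G}_{\le}(B^{k(w)}\times-)$ is a $\mathsf{Samp}_{\mathbb{R}_{\ge0}}$-graded monad on $\mathbf{Meas}$, with unit given by Dirac measures and multiplication $\mathcal{G}_{\le}(B^{j}\times\mathcal{G}_{\le}(B^{k}\times X))\to\mathcal{G}_{\le}(B^{j+k}\times X)$, $\Phi\mapsto\big(S\mapsto\int\rho(\{(c,z):(b,c,z)\in S\})\,\Phi(db,d\rho)\big)$. Corresponding graded coalgebra: $\hat\gamma_w\colon X\to\mathcal{G}_{\le}(B^{k(w)}\times X)$ where $\hat\gamma_{(t,k)}(x)$ is the push-forward of $\gamma_t(x)$ along $z\mapsto(\mathrm{obs}(z),\dots,\mathrm{obs}(z),z)$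 ($k$ copies of $\mathrm{obs}(z)$), and $\hat\gamma_{(t_0,k_0,\dots,t_{n+1},k_{n+1})}$ is obtained by first running $\hat\gamma_{(t_0,k_0,\dots,t_n,k_n)}$ and then running $\hat\gamma_{(t_{n+1},k_{n+1})}$ from the resulting state, concatenating the recorded observations. Graded coalgebras: for a $T$-graded monad $N$ with unit $\eta$ and multiplications $\mu^{s,t}$ (where $T$ is a monoid with unit $e$), a graded coalgebra is an object $X$ with maps $\gamma_t\colon X\to N_tX$ such that $\gamma_e=\eta_X$ and $\gamma_{s\cdot t}=\mu^{s,t}_X\circ N_s\gamma_t\circ\gamma_s$; a homomorphism $h\colon(X,\gamma)\to(Y,\delta)$ is a map $h\colon X\to Y$ with $N_th\circ\gamma_t=\delta_t\circ h$ for all $t$. States $x$ of $(X,\gamma)$ and $y$ of $(Y,\delta)$ are behaviourally equivalent if there are a graded coalgebra $(Z,\xi)$ and homomorphisms $g\colon(X,\gamma)\to(Z,\xi)$, $h\colon(Y,\delta)\to(Z,\xi)$ with $g(x)=h(y)$. *)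

theory Defs
  imports "HOL-Probability.Probability"
begin

section \<open>Feller-Dynkin processes\<close>

text \<open>Continuous functions vanishing at infinity.\<close>

definition C0 :: "('a::topological_space \<Rightarrow> real) set" where
  "C0 = {f. continuous_on UNIV f \<and>
            (\<forall>\<epsilon>>0. \<exists>K. compact K \<and> (\<forall>z. z \<notin> K \<longrightarrow> \<bar>f z\<bar> < \<epsilon>))}"

text \<open>
  The subprobability monad is \<^const>\<open>subprob_algebra\<close>. The observation space is
  \<open>B = Pow AP\<close>; \<open>AP\<close> is a set rather than a type so that it may be empty.
  The last two assumptions say that \<open>(\<gamma>\<^sub>t)\<close> induces a strongly continuous
  semigroup on \<^const>\<open>C0\<close>.
\<close>

locale feller_dynkin =
  fixes AP :: "'p set"
    and \<gamma> :: "real \<Rightarrow> 'a::{t2_space, second_countable_topology} \<Rightarrow> 'a measure"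
    and obs :: "'a \<Rightarrow> 'p set"
  assumes finite_AP: "finite AP"
    and locally_compact: "locally_compact_space (euclidean :: 'a topology)"
    and kernel: "\<And>t. 0 \<le> t \<Longrightarrow> \<gamma> t \<in> borel \<rightarrow>\<^sub>M subprob_algebra borel"
    and kernel_zero: "\<And>x. \<gamma> 0 x = return borel x"
    and chapman_kolmogorov:
      "\<And>s t x C. 0 \<le> s \<Longrightarrow> 0 \<le> t \<Longrightarrow> C \<in> sets borel \<Longrightarrow>
         emeasure (\<gamma> (s + t) x) C = (\<integral>\<^sup>+ z. emeasure (\<gamma> t z) C \<partial>\<gamma> s x)"
    and obs_measurable: "obs \<in> borel \<rightarrow>\<^sub>M count_space (Pow AP)"
    and feller: "\<And>t f. 0 \<le> t \<Longrightarrow> f \<in> C0 \<Longrightarrow> (\<lambda>x. \<integral>z. f z \<partial>\<gamma> t x) \<in> C0"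
    and strongly_continuous:
      "\<And>f. f \<in> C0 \<Longrightarrow> uniform_limit UNIV (\<lambda>t x. \<integral>z. f z \<partial>\<gamma> t x) f (at_right 0)"


section \<open>Trajectories and path laws\<close>

text \<open>
  \<open>X \<union> {\<partial>}\<close> is \<^typ>\<open>'a option\<close>, with \<open>\<partial>\<close> being \<^const>\<open>None\<close>. Its topology is
  the one-point compactification. Its \<open>\<sigma>\<close>-algebra is generated by the Borel sets of \<open>X\<close>;
  since \<open>X\<close> is Hausdorff, this is the Borel \<open>\<sigma>\<close>-algebra of the compactification.
\<close>

definition cemetery_space :: "'a::topological_space option measure" where
  "cemetery_space = sigma UNIV ((`) Some ` sets borel)"

definition cemetery_kernel ::
    "(real \<Rightarrow> 'a::topological_space \<Rightarrow> 'a measure) \<Rightarrow> real \<Rightarrow> 'a option \<Rightarrow> 'a option measure" where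
  "cemetery_kernel \<gamma> t z =
     (case z of
        None \<Rightarrow> return cemetery_space None
      | Some x \<Rightarrow> measure_of UNIV (sets cemetery_space)
          (\<lambda>C. emeasure (\<gamma> t x) (Some -` C) + (1 - emeasure (\<gamma> t x) UNIV) * indicator C None))"

text \<open>Trajectories are functions on \<open>{0..}\<close>, hence extensional.\<close>

definition trajectories :: "(real \<Rightarrow> 'a::topological_space option) set" where
  "trajectories =
     {\<omega> \<in> {0..} \<rightarrow>\<^sub>E UNIV.
        (\<forall>t\<ge>0. limitin (Alexandroff_compactification euclidean) \<omega> (\<omega> t) (at_right t)) \<and>
        (\<forall>t>0. \<exists>l. limitin (Alexandroff_compactification euclidean) \<omega> l (at_left t)) \<and>
        (\<forall>s t. 0 \<le> s \<longrightarrow> s \<le> t \<longrightarrow> \<omega> s = None \<longrightarrow> \<omega> t = None)}"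

definition path_space :: "(real \<Rightarrow> 'a::topological_space option) measure" where
  "path_space = restrict_space (\<Pi>\<^sub>M t\<in>{0..}. cemetery_space) trajectories"

text \<open>
  \<open>fdd \<gamma> z [(s\<^sub>1, C\<^sub>1), \<dots>, (s\<^sub>n, C\<^sub>n)]\<close> is the probability, prescribed by the kernels, that
  the process started at \<open>z\<close> is in \<open>C\<^sub>i\<close> at time \<open>s\<^sub>1 + \<dots> + s\<^sub>i\<close> for all \<open>i\<close>.
\<close>

fun fdd :: "(real \<Rightarrow> 'a::topological_space \<Rightarrow> 'a measure) \<Rightarrow> 'a option \<Rightarrow>
            (real \<times> 'a option set) list \<Rightarrow> ennreal" where
  "fdd \<gamma> z [] = 1"
| "fdd \<gamma> z ((s, C) # L) = (\<integral>\<^sup>+ z'. indicator C z' * fdd \<gamma> z' L \<partial>cemetery_kernel \<gamma> s z)"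

text \<open>
  \<open>P\<close> is the law \<open>P\<^sup>x\<close> of the Markov process with transition kernels \<open>\<gamma>\<close> started at \<open>x\<close>.
  The finite-dimensional distributions determine \<open>P\<close> because \<^const>\<open>path_space\<close> is
  generated by the evaluations; its existence for Feller-Dynkin processes is a classical
  theorem, which is not part of the library.
\<close>

definition path_law ::
    "(real \<Rightarrow> 'a::topological_space \<Rightarrow> 'a measure) \<Rightarrow> 'a \<Rightarrow>
     (real \<Rightarrow> 'a option) measure \<Rightarrow> bool" where
  "path_law \<gamma> x P \<longleftrightarrow>
     prob_space P \<and> sets P = sets path_space \<and>
     (\<forall>L. (\<forall>(s, C) \<in> set L. 0 \<le> s \<and> C \<in> sets cemetery_space) \<longrightarrow>
        emeasure P {\<omega> \<in> trajectories. \<forall>i<length L. \<omega> (\<Sum>j\<le>i. fst (L ! j)) \<in> snd (L ! i)}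
          = fdd \<gamma> (Some x) L)"


section \<open>Bisimulation\<close>

text \<open>\<^const>\<open>rel_option\<close> extends \<open>R\<close> by relating \<open>\<partial>\<close> only to itself.\<close>

definition time_closed ::
    "('a::topological_space \<times> 'a) set \<Rightarrow> (real \<Rightarrow> 'a option) set \<Rightarrow> bool" where
  "time_closed R U \<longleftrightarrow>
     (\<forall>\<omega>\<in>U. \<forall>\<omega>'\<in>trajectories.
        (\<forall>t\<ge>0. rel_option (\<lambda>a b. (a, b) \<in> R) (\<omega> t) (\<omega>' t)) \<longrightarrow> \<omega>' \<in> U)"

definition bisimulation ::
    "('a::topological_space \<Rightarrow> 'p set) \<Rightarrow> ('a \<Rightarrow> (real \<Rightarrow> 'a option) measure) \<Rightarrow>
     ('a \<times> 'a) set \<Rightarrow> bool" where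
  "bisimulation obs P R \<longleftrightarrow>
     equiv UNIV R \<and>
     (\<forall>(x, y) \<in> R. obs x = obs y \<and>
        (\<forall>U \<in> sets path_space. time_closed R U \<longrightarrow> emeasure (P x) U = emeasure (P y) U))"

definition bisimilar ::
    "('a::topological_space \<Rightarrow> 'p set) \<Rightarrow> ('a \<Rightarrow> (real \<Rightarrow> 'a option) measure) \<Rightarrow>
     'a \<Rightarrow> 'a \<Rightarrow> bool" where
  "bisimilar obs P x y \<longleftrightarrow> (\<exists>R. bisimulation obs P R \<and> (x, y) \<in> R)"


section \<open>The sampling monoid\<close>

text \<open>
  Normal forms of the free product of \<open>(\<real>\<^sub>\<ge>\<^sub>0, +, 0)\<close> and \<open>(\<nat>, +, 0)\<close>:
  \<open>[(t\<^sub>0, k\<^sub>0), \<dots>, (t\<^sub>n, k\<^sub>n)]\<close> stands for \<open>t\<^sub>0 \<cdot> k\<^sub>0 \<cdots> t\<^sub>n \<cdot> k\<^sub>n\<close>.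
\<close>

type_synonym sample = "(real \<times> nat) list"

definition Samp :: "sample set" where
  "Samp = {w. w \<noteq> [] \<and> (\<forall>i<length w. 0 \<le> fst (w ! i)) \<and>
              (\<forall>i<length w. 1 \<le> i \<longrightarrow> fst (w ! i) \<noteq> 0) \<and>
              (\<forall>i. i + 1 < length w \<longrightarrow> 0 < snd (w ! i))}"

definition samp_one :: sample where
  "samp_one = [(0, 0)]"

text \<open>
  At the junction \<open>\<dots> t \<cdot> k \<cdot> s \<cdot> l \<dots>\<close> a reduction is possible only if \<open>k = 0\<close> or
  \<open>s = 0\<close>; in both cases the reduced pair is \<open>(t + s, k + l)\<close>, and no further reduction arises.
\<close>

definition samp_mult :: "sample \<Rightarrow> sample \<Rightarrow> sample" where
  "samp_mult v w =
     (let (t, k) = last v; (s, l) = hd w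
      in if k = 0 \<or> s = 0 then butlast v @ (t + s, k + l) # tl w else v @ w)"

definition samp_count :: "sample \<Rightarrow> nat" where
  "samp_count w = (\<Sum>(t, k)\<leftarrow>w. k)"


section \<open>The graded monad\<close>

text \<open>
  \<open>B\<^sup>k\<close> is the set of words of length \<open>k\<close> over \<open>B\<close>, so that all the spaces \<open>B\<^sup>k \<times> X\<close> live on
  one type and the identification \<open>B\<^sup>j \<times> B\<^sup>k = B\<^sup>j\<^sup>+\<^sup>k\<close> is concatenation.
  A pitfall: \<^const>\<open>subprob_algebra\<close> of an empty space is empty, whereas the subprobability
  monad contains the zero measure. Behavioural equivalence only involves inhabited spaces.
\<close>

definition gr_space :: "'b set \<Rightarrow> nat \<Rightarrow> 'x measure \<Rightarrow> ('b list \<times> 'x) measure" where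
  "gr_space B k X = count_space {bs. length bs = k \<and> set bs \<subseteq> B} \<Otimes>\<^sub>M X"

definition gr_obj :: "'b set \<Rightarrow> nat \<Rightarrow> 'x measure \<Rightarrow> ('b list \<times> 'x) measure measure" where
  "gr_obj B k X = subprob_algebra (gr_space B k X)"

definition gr_map ::
    "'b set \<Rightarrow> nat \<Rightarrow> 'y measure \<Rightarrow> ('x \<Rightarrow> 'y) \<Rightarrow>
     ('b list \<times> 'x) measure \<Rightarrow> ('b list \<times> 'y) measure" where
  "gr_map B k Y h \<Phi> = distr \<Phi> (gr_space B k Y) (\<lambda>(b, z). (b, h z))"

definition gr_unit :: "'b set \<Rightarrow> 'x measure \<Rightarrow> 'x \<Rightarrow> ('b list \<times> 'x) measure" where
  "gr_unit B X x = return (gr_space B 0 X) ([], x)"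

definition gr_mult ::
    "'b set \<Rightarrow> nat \<Rightarrow> nat \<Rightarrow> 'x measure \<Rightarrow>
     ('b list \<times> ('b list \<times> 'x) measure) measure \<Rightarrow> ('b list \<times> 'x) measure" where
  "gr_mult B j k X \<Phi> = \<Phi> \<bind> (\<lambda>(b, \<rho>). distr \<rho> (gr_space B (j + k) X) (\<lambda>(c, z). (b @ c, z)))"

text \<open>
  Run \<open>\<kappa>\<close>, then \<open>\<kappa>'\<close> from the resulting state, concatenating the observations:
  \<open>\<mu>\<^sup>j\<^sup>,\<^sup>k \<circ> N\<^sub>j \<kappa>' \<circ> \<kappa>\<close>.
\<close>

definition gr_comp ::
    "'b set \<Rightarrow> nat \<Rightarrow> nat \<Rightarrow> 'x measure \<Rightarrow> ('w \<Rightarrow> ('b list \<times> 'x) measure) \<Rightarrow>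
     ('x \<Rightarrow> ('b list \<times> 'x) measure) \<Rightarrow> 'w \<Rightarrow> ('b list \<times> 'x) measure" where
  "gr_comp B j k X \<kappa> \<kappa>' x = gr_mult B j k X (gr_map B j (gr_obj B k X) \<kappa>' (\<kappa> x))"


section \<open>Graded coalgebras\<close>

definition graded_coalgebra ::
    "'b set \<Rightarrow> 'x measure \<Rightarrow> (sample \<Rightarrow> 'x \<Rightarrow> ('b list \<times> 'x) measure) \<Rightarrow> bool" where
  "graded_coalgebra B X \<xi> \<longleftrightarrow>
     (\<forall>w\<in>Samp. \<xi> w \<in> X \<rightarrow>\<^sub>M gr_obj B (samp_count w) X) \<and>
     (\<forall>x\<in>space X. \<xi> samp_one x = gr_unit B X x) \<and>
     (\<forall>v\<in>Samp. \<forall>w\<in>Samp. \<forall>x\<in>space X.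
        \<xi> (samp_mult v w) x = gr_comp B (samp_count v) (samp_count w) X (\<xi> v) (\<xi> w) x)"

definition coalgebra_hom ::
    "'b set \<Rightarrow> 'x measure \<Rightarrow> (sample \<Rightarrow> 'x \<Rightarrow> ('b list \<times> 'x) measure) \<Rightarrow>
     'y measure \<Rightarrow> (sample \<Rightarrow> 'y \<Rightarrow> ('b list \<times> 'y) measure) \<Rightarrow> ('x \<Rightarrow> 'y) \<Rightarrow> bool" where
  "coalgebra_hom B X \<xi> Y \<delta> h \<longleftrightarrow>
     graded_coalgebra B X \<xi> \<and> graded_coalgebra B Y \<delta> \<and> h \<in> X \<rightarrow>\<^sub>M Y \<and>
     (\<forall>w\<in>Samp. \<forall>x\<in>space X. gr_map B (samp_count w) Y h (\<xi> w x) = \<delta> w (h x))"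

text \<open>
  HOL cannot quantify over the carrier type of \<open>Z\<close>. We fix it so that every quotient of the
  disjoint union of \<open>X\<close> and \<open>Y\<close> is available. This loses nothing: given a cospan into any
  \<open>Z\<close>, the set \<open>g X \<union> h Y\<close> with the trace \<open>\<sigma>\<close>-algebra carries a coalgebra structure through
  which both homomorphisms factor, and it is in bijection with a set of equivalence classes of
  that disjoint union.
\<close>

definition behaviourally_equivalent ::
    "'b set \<Rightarrow> 'x measure \<Rightarrow> (sample \<Rightarrow> 'x \<Rightarrow> ('b list \<times> 'x) measure) \<Rightarrow>
     'y measure \<Rightarrow> (sample \<Rightarrow> 'y \<Rightarrow> ('b list \<times> 'y) measure) \<Rightarrow> 'x \<Rightarrow> 'y \<Rightarrow> bool" where
  "behaviourally_equivalent B X \<xi> Y \<delta> x y \<longleftrightarrow>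
     x \<in> space X \<and> y \<in> space Y \<and>
     (\<exists>(Z :: ('x + 'y) set measure) \<zeta> g h.
        coalgebra_hom B X \<xi> Z \<zeta> g \<and> coalgebra_hom B Y \<delta> Z \<zeta> h \<and> g x = h y)"


section \<open>The graded coalgebra of a process\<close>

definition sample_step ::
    "'b set \<Rightarrow> (real \<Rightarrow> 'a::topological_space \<Rightarrow> 'a measure) \<Rightarrow> ('a \<Rightarrow> 'b) \<Rightarrow>
     real \<times> nat \<Rightarrow> 'a \<Rightarrow> ('b list \<times> 'a) measure" where
  "sample_step B \<gamma> obs = (\<lambda>(t, k) x.
     distr (\<gamma> t x) (gr_space B k borel) (\<lambda>z. (replicate k (obs z), z)))"

text \<open>The recursion extends a sample at its end, hence runs over the reversed list.\<close>

primrec sampled_rev ::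
    "'b set \<Rightarrow> (real \<Rightarrow> 'a::topological_space \<Rightarrow> 'a measure) \<Rightarrow> ('a \<Rightarrow> 'b) \<Rightarrow>
     sample \<Rightarrow> 'a \<Rightarrow> ('b list \<times> 'a) measure" where
  "sampled_rev B \<gamma> obs [] = gr_unit B borel"
| "sampled_rev B \<gamma> obs (p # u) =
     (if u = [] then sample_step B \<gamma> obs p
      else gr_comp B (samp_count u) (snd p) borel
             (sampled_rev B \<gamma> obs u) (sample_step B \<gamma> obs p))"

definition sampled_coalgebra ::
    "'b set \<Rightarrow> (real \<Rightarrow> 'a::topological_space \<Rightarrow> 'a measure) \<Rightarrow> ('a \<Rightarrow> 'b) \<Rightarrow>
     sample \<Rightarrow> 'a \<Rightarrow> ('b list \<times> 'a) measure" where
  "sampled_coalgebra B \<gamma> obs w = sampled_rev B \<gamma> obs (rev w)"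


section \<open>Checks of the encodings\<close>

lemma samp_one_in_Samp: "samp_one \<in> Samp"
  by (simp add: Samp_def samp_one_def)

lemma Samp_Cons:
  "p # v \<in> Samp \<longleftrightarrow> 0 \<le> fst p \<and> (v \<noteq> [] \<longrightarrow> v \<in> Samp \<and> 0 < snd p \<and> fst (hd v) \<noteq> 0)"
  by (cases v) (auto simp: Samp_def nth_Cons All_less_Suc2 split: nat.splits)

lemma Samp_append:
  assumes "w \<noteq> []"
  shows "u @ w \<in> Samp \<longleftrightarrow>
    w \<in> Samp \<and> (u \<noteq> [] \<longrightarrow> u \<in> Samp \<and> 0 < snd (last u) \<and> fst (hd w) \<noteq> 0)"
  using assms
proof (induction u)
  case Nil
  then show ?case by simp
next
  case (Cons p u)
  show ?case
    using Cons by (cases u) (auto simp: Samp_Cons)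
qed

lemma samp_mult_snoc_Cons:
  "samp_mult (u @ [(t, k)]) ((s, l) # w) =
     (if k = 0 \<or> s = 0 then u @ (t + s, k + l) # w else u @ (t, k) # (s, l) # w)"
  by (simp add: samp_mult_def)

lemma Samp_nonempty: "w \<in> Samp \<Longrightarrow> w \<noteq> []"
  by (simp add: Samp_def)

lemma samp_mult_closed:
  assumes "v \<in> Samp" "w \<in> Samp"
  shows "samp_mult v w \<in> Samp"
proof -
  obtain u t k where v: "v = u @ [(t, k)]"
    using Samp_nonempty[OF assms(1)] by (metis rev_exhaust surj_pair)
  obtain s l r where w: "w = (s, l) # r"
    using Samp_nonempty[OF assms(2)] by (metis list.exhaust surj_pair)
  show ?thesis
    using assms unfolding v w samp_mult_snoc_Cons
    by (auto simp: Samp_append Samp_Cons split: if_splits)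
qed

lemma samp_mult_one:
  assumes "w \<in> Samp"
  shows "samp_mult samp_one w = w" "samp_mult w samp_one = w"
proof -
  obtain u t k where v: "w = u @ [(t, k)]"
    using Samp_nonempty[OF assms] by (metis rev_exhaust surj_pair)
  show "samp_mult w samp_one = w"
    by (simp add: v samp_one_def samp_mult_snoc_Cons)
  obtain s l r where w: "w = (s, l) # r"
    using Samp_nonempty[OF assms] by (metis list.exhaust surj_pair)
  show "samp_mult samp_one w = w"
    by (simp add: w samp_one_def samp_mult_def)
qed

lemma samp_mult_assoc:
  assumes "u \<in> Samp" "v \<in> Samp" "w \<in> Samp"
  shows "samp_mult (samp_mult u v) w = samp_mult u (samp_mult v w)"
proof -
  obtain u' t k where u: "u = u' @ [(t, k)]"
    using Samp_nonempty[OF assms(1)] by (metis rev_exhaust surj_pair)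
  obtain r m w' where w: "w = (r, m) # w'"
    using Samp_nonempty[OF assms(3)] by (metis list.exhaust surj_pair)
  obtain s l v' where v: "v = (s, l) # v'"
    using Samp_nonempty[OF assms(2)] by (metis list.exhaust surj_pair)
  have r: "0 \<le> r" and s: "0 \<le> s"
    using assms by (auto simp: v w Samp_Cons)
  show ?thesis
  proof (cases v' rule: rev_cases)
    case Nil
    have "s + r = 0 \<longleftrightarrow> s = 0 \<and> r = 0"
      using r s by linarith
    then show ?thesis
      by (auto simp: samp_mult_def Let_def u v w Nil butlast_append split: prod.splits)
  next
    case (snoc v'' p)
    then show ?thesis
      by (auto simp: samp_mult_def Let_def u v w butlast_append split: prod.splits)
  qed
qed

text \<open>The two embeddings are homomorphisms and their images generate \<^const>\<open>Samp\<close>.\<close>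

lemma samp_mult_embeddings:
  "samp_mult [(s, 0)] [(t, 0)] = [(s + t, 0)]"
  "samp_mult [(0, j)] [(0, k)] = [(0, j + k)]"
  by (simp_all add: samp_mult_def)

lemma Samp_generated:
  assumes "w \<in> Samp"
  shows "w = foldr (\<lambda>(t, k) v. samp_mult [(t, 0)] (samp_mult [(0, k)] v)) w samp_one"
  using assms
proof (induction w)
  case Nil
  then show ?case by (simp add: Samp_def)
next
  case (Cons p w)
  show ?case
  proof (cases w)
    case Nil
    then show ?thesis by (cases p) (simp add: samp_mult_def samp_one_def)
  next
    case (Cons q w')
    have "w \<in> Samp" "0 < snd p" "fst q \<noteq> 0"
      using Cons.prems Cons by (auto simp: Samp_Cons)
    then have "samp_mult [(fst p, 0)] (samp_mult [(0, snd p)] w) = p # w"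
      by (cases p; cases q) (simp add: samp_mult_def Cons)
    then show ?thesis
      using Cons.IH[OF \<open>w \<in> Samp\<close>] by (simp add: case_prod_beta)
  qed
qed

lemma samp_count_mult:
  assumes "v \<in> Samp" "w \<in> Samp"
  shows "samp_count (samp_mult v w) = samp_count v + samp_count w"
proof -
  obtain u t k where v: "v = u @ [(t, k)]"
    using Samp_nonempty[OF assms(1)] by (metis rev_exhaust surj_pair)
  obtain s l r where w: "w = (s, l) # r"
    using Samp_nonempty[OF assms(2)] by (metis list.exhaust surj_pair)
  show ?thesis
    by (simp add: v w samp_mult_snoc_Cons samp_count_def)
qed

lemma sets_cemetery_space:
  "sets cemetery_space = sigma_sets UNIV ((`) Some ` sets borel)"
  by (simp add: cemetery_space_def)

lemma measurable_Some_cemetery: "Some \<in> borel \<rightarrow>\<^sub>M cemetery_space"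
  unfolding cemetery_space_def
  by (rule measurable_measure_of) (auto simp: inj_vimage_image_eq)

lemma emeasure_cemetery_kernel:
  fixes \<gamma> :: "real \<Rightarrow> 'a::topological_space \<Rightarrow> 'a measure"
  assumes "sets (\<gamma> t x) = sets borel" "C \<in> sets cemetery_space"
  shows "emeasure (cemetery_kernel \<gamma> t (Some x)) C =
    emeasure (\<gamma> t x) (Some -` C) + (1 - emeasure (\<gamma> t x) UNIV) * indicator C None"
proof -
  let ?M = "cemetery_space :: 'a option measure"
  let ?c = "1 - emeasure (\<gamma> t x) UNIV"
  let ?f = "\<lambda>C. emeasure (\<gamma> t x) (Some -` C) + ?c * indicator C None"
  have [simp]: "space ?M = UNIV"
    by (simp add: cemetery_space_def)
  have sp: "space (\<gamma> t x) = UNIV"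
    using sets_eq_imp_space_eq[OF assms(1)] by simp
  have m: "Some \<in> \<gamma> t x \<rightarrow>\<^sub>M ?M"
    using measurable_Some_cemetery measurable_cong_sets[OF assms(1) refl] by blast
  let ?\<mu> = "\<lambda>D. emeasure (distr (\<gamma> t x) ?M Some) D"
  let ?\<nu> = "\<lambda>D. emeasure (return ?M None) D"
  have eq: "?f D = ?\<mu> D + ?c * ?\<nu> D" if "D \<in> sets ?M" for D
    using that m by (simp add: emeasure_distr sp)
  have "countably_additive (sets ?M) ?f"
  proof (rule countably_additiveI)
    fix A :: "nat \<Rightarrow> 'a option set" assume A: "range A \<subseteq> sets ?M" "disjoint_family A"
    have "(\<Sum>i. ?f (A i)) = (\<Sum>i. ?\<mu> (A i) + ?c * ?\<nu> (A i))"
      using A(1) by (intro suminf_cong eq) blast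
    also have "\<dots> = (\<Sum>i. ?\<mu> (A i)) + ?c * (\<Sum>i. ?\<nu> (A i))"
      by (subst suminf_add[symmetric]) (simp_all only: summableI ennreal_suminf_cmult)
    also have "\<dots> = ?\<mu> (\<Union>i. A i) + ?c * ?\<nu> (\<Union>i. A i)"
      using A by (subst (1 2) suminf_emeasure) (simp_all only: sets_distr sets_return)
    also have "\<dots> = ?f (\<Union>i. A i)"
      using A(1) by (intro eq[symmetric]) blast
    finally show "(\<Sum>i. ?f (A i)) = ?f (\<Union>i. A i)" .
  qed
  moreover have "positive (sets ?M) ?f"
    by (simp add: positive_def)
  ultimately show ?thesis
    using assms(2) sets.sigma_algebra_axioms[of ?M]
    by (simp add: cemetery_kernel_def emeasure_measure_of_sigma)
qed

lemma emeasure_gr_mult: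
  assumes "finite B"
  assumes "\<Phi> \<in> space (gr_obj B j (gr_obj B k X))" "S \<in> sets (gr_space B (j + k) X)"
  shows "emeasure (gr_mult B j k X \<Phi>) S =
    (\<integral>\<^sup>+ (b, \<rho>). emeasure \<rho> {(c, z) \<in> space (gr_space B k X). (b @ c, z) \<in> S} \<partial>\<Phi>)"
proof -
  let ?W = "\<lambda>k. count_space {bs. length bs = k \<and> set bs \<subseteq> B}"
  let ?D = "\<lambda>(b, \<rho>). distr \<rho> (gr_space B (j + k) X) (\<lambda>(c, z). (b @ c, z))"
  have sets_\<Phi>: "sets \<Phi> = sets (gr_space B j (gr_obj B k X))"
    using assms(2) by (simp add: gr_obj_def space_subprob_algebra)
  have sp_\<Phi>: "space \<Phi> \<noteq> {}"
    using assms(2) by (auto simp: gr_obj_def space_subprob_algebra dest: subprob_space.subprob_not_empty)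
  have app: "(\<lambda>(c, z). (b @ c, z)) \<in> gr_space B k X \<rightarrow>\<^sub>M gr_space B (j + k) X"
    if "b \<in> space (?W j)" for b
  proof -
    have "(\<lambda>c. b @ c) \<in> ?W k \<rightarrow>\<^sub>M ?W (j + k)"
      using that by auto
    then show ?thesis
      unfolding gr_space_def by measurable
  qed
  have D: "?D \<in> \<Phi> \<rightarrow>\<^sub>M subprob_algebra (gr_space B (j + k) X)"
  proof -
    have "?D \<in> ?W j \<Otimes>\<^sub>M gr_obj B k X \<rightarrow>\<^sub>M subprob_algebra (gr_space B (j + k) X)"
      unfolding gr_obj_def
    proof (rule measurable_pair_measure_countable1)
      show "countable {bs. length bs = j \<and> set bs \<subseteq> B}"
        using finite_lists_length_eq[OF assms(1), of j]
        by (simp add: conj_commute countable_finite)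
      fix b assume "b \<in> {bs. length bs = j \<and> set bs \<subseteq> B}"
      then show "(\<lambda>\<rho>. ?D (b, \<rho>)) \<in> subprob_algebra (gr_space B k X) \<rightarrow>\<^sub>M
                   subprob_algebra (gr_space B (j + k) X)"
        using measurable_distr[OF app] by simp
    qed
    then show ?thesis
      using sets_\<Phi> by (simp add: gr_space_def cong: measurable_cong_sets)
  qed
  have "emeasure (gr_mult B j k X \<Phi>) S = (\<integral>\<^sup>+ p. emeasure (?D p) S \<partial>\<Phi>)"
    unfolding gr_mult_def by (rule emeasure_bind[OF sp_\<Phi> D assms(3)])
  also have "\<dots> = (\<integral>\<^sup>+ (b, \<rho>). emeasure \<rho> {(c, z) \<in> space (gr_space B k X). (b @ c, z) \<in> S} \<partial>\<Phi>)"
  proof (rule nn_integral_cong)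
    fix p assume "p \<in> space \<Phi>"
    moreover obtain b \<rho> where p: "p = (b, \<rho>)"
      by (cases p)
    ultimately have b: "b \<in> space (?W j)" and \<rho>: "sets \<rho> = sets (gr_space B k X)"
      using sets_eq_imp_space_eq[OF sets_\<Phi>]
      by (auto simp: gr_space_def space_pair_measure gr_obj_def space_subprob_algebra)
    have "(\<lambda>(c, z). (b @ c, z)) \<in> \<rho> \<rightarrow>\<^sub>M gr_space B (j + k) X"
      using app[OF b] measurable_cong_sets[OF \<rho> refl] by blast
    then show "emeasure (?D p) S =
        (case p of (b, \<rho>) \<Rightarrow> emeasure \<rho> {(c, z) \<in> space (gr_space B k X). (b @ c, z) \<in> S})"
      using assms(3) sets_eq_imp_space_eq[OF \<rho>]
      by (auto simp: p emeasure_distr intro!: arg_cong[where f = "emeasure \<rho>"])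
  qed
  finally show ?thesis .
qed

lemma sampled_coalgebra_snoc:
  "sampled_coalgebra B \<gamma> obs [p] = sample_step B \<gamma> obs p"
  "u \<noteq> [] \<Longrightarrow> sampled_coalgebra B \<gamma> obs (u @ [p]) =
     gr_comp B (samp_count u) (snd p) borel (sampled_coalgebra B \<gamma> obs u) (sample_step B \<gamma> obs p)"
  by (simp_all add: sampled_coalgebra_def samp_count_def flip: rev_map)

end

theory Submission
  imports Defs
begin

text \<open>
  If \<open>C\<close> is an \<open>R\<close>-closed Borel set, the trajectories with \<open>\<omega> t \<in> C\<close> form a measurable
  time-\<open>R\<close>-closed set, so bisimilar states have the same transition probability
  \<open>\<gamma> t _ C\<close>. Hence every one-step kernel descends to the quotient of \<open>X\<close> by \<open>R\<close>,
  equipped with the final \<open>\<sigma>\<close>-algebra. Since the composition of graded kernels is natural in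
  the state space, all sampled kernels descend as well. The quotient is thus a graded coalgebra,
  and the quotient map is a homomorphism identifying bisimilar states.
\<close>

section \<open>Composition of graded kernels\<close>

lemma space_gr_space:
  "space (gr_space B k X) = {bs. length bs = k \<and> set bs \<subseteq> B} \<times> space X"
  by (simp add: gr_space_def space_pair_measure)

lemma space_gr_obj_sets: "\<Phi> \<in> space (gr_obj B k X) \<Longrightarrow> sets \<Phi> = sets (gr_space B k X)"
  by (simp add: gr_obj_def space_subprob_algebra)

lemma measurable_gr_kernel_sets:
  "\<kappa> \<in> W \<rightarrow>\<^sub>M gr_obj B k X \<Longrightarrow> x \<in> space W \<Longrightarrow> sets (\<kappa> x) = sets (gr_space B k X)"
  by (rule space_gr_obj_sets[OF measurable_space])

lemma space_gr_obj_nonempty: "\<Phi> \<in> space (gr_obj B k X) \<Longrightarrow> space \<Phi> \<noteq> {}"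
  by (auto simp: gr_obj_def space_subprob_algebra dest: subprob_space.subprob_not_empty)

text \<open>For finite \<open>B\<close> there are only finitely many words of length
  \<open>k\<close>, so the word component is countable and discrete, and measurability may be tested
  with the word held fixed.\<close>

lemma measurable_gr_spaceI:
  assumes "finite B"
    and "\<And>b. length b = k \<Longrightarrow> set b \<subseteq> B \<Longrightarrow> (\<lambda>z. f (b, z)) \<in> X \<rightarrow>\<^sub>M N"
  shows "f \<in> gr_space B k X \<rightarrow>\<^sub>M N"
  unfolding gr_space_def
proof (rule measurable_pair_measure_countable1)
  show "countable {bs. length bs = k \<and> set bs \<subseteq> B}"
    using finite_lists_length_eq[OF assms(1), of k] by (simp add: conj_commute countable_finite)
qed (use assms(2) in simp)

lemma measurable_gr_append:
  assumes "length b = j" "set b \<subseteq> B"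
  shows "(\<lambda>(c, z). (b @ c, z)) \<in> gr_space B k X \<rightarrow>\<^sub>M gr_space B (j + k) X"
proof -
  have "(\<lambda>c. b @ c) \<in> count_space {bs. length bs = k \<and> set bs \<subseteq> B}
      \<rightarrow>\<^sub>M count_space {bs. length bs = j + k \<and> set bs \<subseteq> B}"
    using assms by auto
  then show ?thesis
    unfolding gr_space_def by measurable
qed

lemma measurable_gr_mapfun:
  assumes "h \<in> X \<rightarrow>\<^sub>M Y"
  shows "(\<lambda>(b, z). (b, h z)) \<in> gr_space B k X \<rightarrow>\<^sub>M gr_space B k Y"
  using assms unfolding gr_space_def by measurable

lemma measurable_gr_map:
  assumes "h \<in> X \<rightarrow>\<^sub>M Y"
  shows "gr_map B k Y h \<in> gr_obj B k X \<rightarrow>\<^sub>M gr_obj B k Y"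
  unfolding gr_map_def gr_obj_def by (rule measurable_distr[OF measurable_gr_mapfun[OF assms]])

lemma nn_integral_gr_map:
  assumes "h \<in> X \<rightarrow>\<^sub>M Y" "sets \<Phi> = sets (gr_space B k X)"
    and "f \<in> borel_measurable (gr_space B k Y)"
  shows "(\<integral>\<^sup>+ p. f p \<partial>gr_map B k Y h \<Phi>) = (\<integral>\<^sup>+ (b, z). f (b, h z) \<partial>\<Phi>)"
proof -
  have "(\<lambda>(b, z). (b, h z)) \<in> \<Phi> \<rightarrow>\<^sub>M gr_space B k Y"
    using measurable_gr_mapfun[OF assms(1)] measurable_cong_sets[OF assms(2) refl] by blast
  then show ?thesis
    unfolding gr_map_def using assms(3)
    by (subst nn_integral_distr) (simp_all add: case_prod_beta')
qed

section \<open>Composition as Kleisli composition and as an iterated integral\<close>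

lemma measurable_gr_extend:
  assumes "finite B" "\<kappa>' \<in> X \<rightarrow>\<^sub>M gr_obj B k Y"
  shows "(\<lambda>(b, z). distr (\<kappa>' z) (gr_space B (j + k) Y) (\<lambda>(c, z'). (b @ c, z')))
    \<in> gr_space B j X \<rightarrow>\<^sub>M gr_obj B (j + k) Y"
proof (rule measurable_gr_spaceI[OF assms(1)])
  fix b assume "length b = j" "set b \<subseteq> B"
  from measurable_compose[OF assms(2)[unfolded gr_obj_def] measurable_distr[OF measurable_gr_append[OF this]]]
  show "(\<lambda>z. case (b, z) of (b, z) \<Rightarrow> distr (\<kappa>' z) (gr_space B (j + k) Y) (\<lambda>(c, z'). (b @ c, z')))
      \<in> X \<rightarrow>\<^sub>M gr_obj B (j + k) Y"
    by (simp add: gr_obj_def)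
qed

text \<open>The intermediate measure on measures disappears: binding a push-forward along
  \<open>\<kappa>'\<close> is binding the composite map. What remains is Kleisli composition, with
  the observations already made prefixed to the new ones.\<close>

lemma gr_comp_eq_bind:
  assumes "finite B" "\<kappa> \<in> W \<rightarrow>\<^sub>M gr_obj B j X" "x \<in> space W" "\<kappa>' \<in> X \<rightarrow>\<^sub>M gr_obj B k X"
  shows "gr_comp B j k X \<kappa> \<kappa>' x =
    \<kappa> x \<bind> (\<lambda>(b, z). distr (\<kappa>' z) (gr_space B (j + k) X) (\<lambda>(c, z'). (b @ c, z')))"
proof -
  note \<kappa>x = measurable_space[OF assms(2,3)]
  note s = space_gr_obj_sets[OF \<kappa>x]
  have m: "(\<lambda>(b, z). (b, \<kappa>' z)) \<in> \<kappa> x \<rightarrow>\<^sub>M gr_space B j (gr_obj B k X)"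
    using measurable_gr_mapfun[OF assms(4)] measurable_cong_sets[OF s refl] by blast
  \<comment> \<open>The multiplication is the extension of the identity kernel on
    \<open>gr_obj B k X\<close>, which explains the instance of
    \<open>measurable_gr_extend\<close>.\<close>
  have "(\<lambda>(b, \<rho>). distr \<rho> (gr_space B (j + k) X) (\<lambda>(c, z). (b @ c, z)))
      \<in> gr_space B j (gr_obj B k X) \<rightarrow>\<^sub>M subprob_algebra (gr_space B (j + k) X)"
    using measurable_gr_extend[OF assms(1), of "\<lambda>\<rho>. \<rho>" "gr_obj B k X" k X j]
    by (simp add: gr_obj_def)
  from bind_distr[OF m this space_gr_obj_nonempty[OF \<kappa>x]] show ?thesis
    by (simp add: gr_comp_def gr_mult_def gr_map_def case_prod_beta')
qed

lemma measurable_gr_comp: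
  assumes "finite B" "\<kappa> \<in> W \<rightarrow>\<^sub>M gr_obj B j X" "\<kappa>' \<in> X \<rightarrow>\<^sub>M gr_obj B k X"
  shows "gr_comp B j k X \<kappa> \<kappa>' \<in> W \<rightarrow>\<^sub>M gr_obj B (j + k) X"
proof -
  have "(\<lambda>x. \<kappa> x \<bind> (\<lambda>(b, z). distr (\<kappa>' z) (gr_space B (j + k) X) (\<lambda>(c, z'). (b @ c, z'))))
      \<in> W \<rightarrow>\<^sub>M gr_obj B (j + k) X"
    using measurable_bind2 assms(2) measurable_gr_extend[OF assms(1,3)]
    unfolding gr_obj_def by blast
  then show ?thesis
    by (subst measurable_cong[OF gr_comp_eq_bind[OF assms(1,2) _ assms(3)]])
qed

text \<open>This formula turns laws for \<open>gr_comp\<close> into equalities of iterated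
  integrals: integration over a bind is iterated, and a change of variables moves the prefix
  \<open>b\<close> into \<open>f\<close>.\<close>

lemma nn_integral_gr_comp:
  assumes "finite B" "\<kappa> \<in> W \<rightarrow>\<^sub>M gr_obj B j X" "x \<in> space W" "\<kappa>' \<in> X \<rightarrow>\<^sub>M gr_obj B k X"
    and f: "f \<in> borel_measurable (gr_space B (j + k) X)"
  shows "(\<integral>\<^sup>+ p. f p \<partial>gr_comp B j k X \<kappa> \<kappa>' x) =
    (\<integral>\<^sup>+ (b, z). (\<integral>\<^sup>+ (c, z'). f (b @ c, z') \<partial>\<kappa>' z) \<partial>\<kappa> x)"
proof -
  let ?E = "\<lambda>(b, z). distr (\<kappa>' z) (gr_space B (j + k) X) (\<lambda>(c, z'). (b @ c, z'))"
  note s = measurable_gr_kernel_sets[OF assms(2,3)]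
  have E: "?E \<in> \<kappa> x \<rightarrow>\<^sub>M subprob_algebra (gr_space B (j + k) X)"
    using measurable_gr_extend[OF assms(1,4)] measurable_cong_sets[OF s refl]
    unfolding gr_obj_def by blast
  have "(\<integral>\<^sup>+ p. f p \<partial>gr_comp B j k X \<kappa> \<kappa>' x) = (\<integral>\<^sup>+ q. (\<integral>\<^sup>+ p. f p \<partial>?E q) \<partial>\<kappa> x)"
    unfolding gr_comp_eq_bind[OF assms(1-4)] by (rule nn_integral_bind[OF f E])
  also have "\<dots> = (\<integral>\<^sup>+ (b, z). (\<integral>\<^sup>+ (c, z'). f (b @ c, z') \<partial>\<kappa>' z) \<partial>\<kappa> x)"
  proof (rule nn_integral_cong)
    fix q assume "q \<in> space (\<kappa> x)"
    then obtain b z where q: "q = (b, z)" "length b = j" "set b \<subseteq> B" "z \<in> space X"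
      using sets_eq_imp_space_eq[OF s] by (auto simp: space_gr_space)
    have "(\<lambda>(c, z). (b @ c, z)) \<in> \<kappa>' z \<rightarrow>\<^sub>M gr_space B (j + k) X"
      using measurable_gr_append[OF q(2,3)]
        measurable_cong_sets[OF measurable_gr_kernel_sets[OF assms(4) q(4)] refl] by blast
    then show "(\<integral>\<^sup>+ p. f p \<partial>?E q) = (case q of (b, z) \<Rightarrow> \<integral>\<^sup>+ (c, z'). f (b @ c, z') \<partial>\<kappa>' z)"
      by (simp add: q(1) nn_integral_distr f case_prod_beta')
  qed
  finally show ?thesis .
qed

text \<open>The inner integral of \<open>nn_integral_gr_comp\<close> is itself a legitimate
  integrand, which allows the formula to be applied again to nested composites.\<close>

lemma measurable_gr_integral:
  assumes "finite B" "\<kappa>' \<in> X \<rightarrow>\<^sub>M gr_obj B k Y" and f: "f \<in> borel_measurable (gr_space B (j + k) Y)"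
  shows "(\<lambda>(b, z). \<integral>\<^sup>+ (c, z'). f (b @ c, z') \<partial>\<kappa>' z) \<in> borel_measurable (gr_space B j X)"
proof (rule measurable_gr_spaceI[OF assms(1)])
  fix b assume b: "length b = j" "set b \<subseteq> B"
  have "(\<lambda>(c, z'). f (b @ c, z')) \<in> borel_measurable (gr_space B k Y)"
    using measurable_compose[OF measurable_gr_append[OF b] f] by (simp add: case_prod_beta')
  from measurable_compose[OF assms(2)[unfolded gr_obj_def] nn_integral_measurable_subprob_algebra[OF this]]
  show "(\<lambda>z. case (b, z) of (b, z) \<Rightarrow> \<integral>\<^sup>+ (c, z'). f (b @ c, z') \<partial>\<kappa>' z) \<in> borel_measurable X"
    by simp
qed

section \<open>Associativity and unit laws of the composition\<close>

lemma measure_eq_nn_integralI: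
  assumes "sets M = sets L" "sets N = sets L"
    and "\<And>f. f \<in> borel_measurable L \<Longrightarrow> (\<integral>\<^sup>+ p. f p \<partial>M) = (\<integral>\<^sup>+ p. f p \<partial>N)"
  shows "M = N"
proof (rule measure_eqI)
  fix A assume A: "A \<in> sets M"
  then have "(\<integral>\<^sup>+ p. indicator A p \<partial>M) = (\<integral>\<^sup>+ p. indicator A p \<partial>N)"
    using assms(1) by (intro assms(3)) simp
  then show "emeasure M A = emeasure N A"
    using A assms(1,2) by simp
qed (simp add: assms)

text \<open>Both sides integrate \<open>f\<close> to the same triple integral, because concatenation
  of words is associative. Grades are natural numbers, so both bracketings of the grade give the
  same space.\<close>

lemma gr_comp_assoc:
  assumes B: "finite B" and \<kappa>: "\<kappa> \<in> W \<rightarrow>\<^sub>M gr_obj B i X" and x: "x \<in> space W"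
    and \<kappa>': "\<kappa>' \<in> X \<rightarrow>\<^sub>M gr_obj B j X" and \<kappa>'': "\<kappa>'' \<in> X \<rightarrow>\<^sub>M gr_obj B k X"
  shows "gr_comp B (i + j) k X (gr_comp B i j X \<kappa> \<kappa>') \<kappa>'' x =
    gr_comp B i (j + k) X \<kappa> (gr_comp B j k X \<kappa>' \<kappa>'') x" (is "?L = ?R")
proof (rule measure_eq_nn_integralI)
  note c = measurable_gr_comp[OF B \<kappa> \<kappa>']
  note m = measurable_gr_comp[OF B \<kappa>' \<kappa>'']
  show "sets ?L = sets (gr_space B (i + j + k) X)"
    using measurable_gr_kernel_sets[OF measurable_gr_comp[OF B c \<kappa>''] x] .
  show "sets ?R = sets (gr_space B (i + j + k) X)"
    using measurable_gr_kernel_sets[OF measurable_gr_comp[OF B \<kappa> m] x] by (simp add: add.assoc)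
  fix f :: "_ \<Rightarrow> ennreal" assume f: "f \<in> borel_measurable (gr_space B (i + j + k) X)"
  then have f': "f \<in> borel_measurable (gr_space B (i + (j + k)) X)"
    by (simp add: add.assoc)
  have "(\<integral>\<^sup>+ p. f p \<partial>?L) = (\<integral>\<^sup>+ (b, z). (\<integral>\<^sup>+ (d, z'). f (b @ d, z') \<partial>\<kappa>'' z) \<partial>gr_comp B i j X \<kappa> \<kappa>' x)"
    by (rule nn_integral_gr_comp[OF B c x \<kappa>'' f])
  also have "\<dots> = (\<integral>\<^sup>+ (b, z). (\<integral>\<^sup>+ (c, z'). (\<integral>\<^sup>+ (d, z''). f (b @ c @ d, z'') \<partial>\<kappa>'' z') \<partial>\<kappa>' z) \<partial>\<kappa> x)"
    by (subst nn_integral_gr_comp[OF B \<kappa> x \<kappa>' measurable_gr_integral[OF B \<kappa>'' f]]) simp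
  also have "\<dots> = (\<integral>\<^sup>+ (b, z). (\<integral>\<^sup>+ (c, z'). f (b @ c, z') \<partial>gr_comp B j k X \<kappa>' \<kappa>'' z) \<partial>\<kappa> x)"
  proof (rule nn_integral_cong)
    fix q assume "q \<in> space (\<kappa> x)"
    then obtain b z where q: "q = (b, z)" "length b = i" "set b \<subseteq> B" "z \<in> space X"
      using sets_eq_imp_space_eq[OF measurable_gr_kernel_sets[OF \<kappa> x]] by (auto simp: space_gr_space)
    have "(\<lambda>(c, z'). f (b @ c, z')) \<in> borel_measurable (gr_space B (j + k) X)"
      using measurable_compose[OF measurable_gr_append[OF q(2,3)] f'] by (simp add: case_prod_beta')
    from nn_integral_gr_comp[OF B \<kappa>' q(4) \<kappa>'' this]
    show "(case q of (b, z) \<Rightarrow> \<integral>\<^sup>+ (c, z'). (\<integral>\<^sup>+ (d, z''). f (b @ c @ d, z'') \<partial>\<kappa>'' z') \<partial>\<kappa>' z) =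
        (case q of (b, z) \<Rightarrow> \<integral>\<^sup>+ (c, z'). f (b @ c, z') \<partial>gr_comp B j k X \<kappa>' \<kappa>'' z)"
      by (simp add: q(1))
  qed
  also have "\<dots> = (\<integral>\<^sup>+ p. f p \<partial>?R)"
    by (rule nn_integral_gr_comp[OF B \<kappa> x m f', symmetric])
  finally show "(\<integral>\<^sup>+ p. f p \<partial>?L) = (\<integral>\<^sup>+ p. f p \<partial>?R)" .
qed

lemma measurable_gr_unit: "gr_unit B X \<in> X \<rightarrow>\<^sub>M gr_obj B 0 X"
proof -
  have "Pair [] \<in> X \<rightarrow>\<^sub>M gr_space B 0 X"
    unfolding gr_space_def by (intro measurable_Pair1') simp
  from measurable_compose[OF this return_measurable] show ?thesis
    by (simp add: gr_unit_def[abs_def] gr_obj_def)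
qed

text \<open>The outer integral is evaluation at \<open>([], x)\<close>, and prefixing the empty word
  changes nothing.\<close>

lemma gr_comp_unit_left:
  assumes B: "finite B" and \<kappa>: "\<kappa> \<in> X \<rightarrow>\<^sub>M gr_obj B k X" and x: "x \<in> space X"
  shows "gr_comp B 0 k X (gr_unit B X) \<kappa> x = \<kappa> x"
proof (rule measure_eq_nn_integralI)
  note u = measurable_gr_unit[of B X]
  show "sets (gr_comp B 0 k X (gr_unit B X) \<kappa> x) = sets (gr_space B k X)"
    using measurable_gr_kernel_sets[OF measurable_gr_comp[OF B u \<kappa>] x] by simp
  show "sets (\<kappa> x) = sets (gr_space B k X)"
    by (rule measurable_gr_kernel_sets[OF \<kappa> x])
  fix f :: "_ \<Rightarrow> ennreal" assume f: "f \<in> borel_measurable (gr_space B k X)"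
  then have f': "f \<in> borel_measurable (gr_space B (0 + k) X)" by simp
  show "(\<integral>\<^sup>+ p. f p \<partial>gr_comp B 0 k X (gr_unit B X) \<kappa> x) = (\<integral>\<^sup>+ p. f p \<partial>\<kappa> x)"
    using measurable_gr_integral[OF B \<kappa> f'] x
    unfolding nn_integral_gr_comp[OF B u x \<kappa> f'] gr_unit_def
    by (subst nn_integral_return) (simp_all add: space_gr_space)
qed

lemma gr_comp_unit_right:
  assumes B: "finite B" and \<kappa>: "\<kappa> \<in> W \<rightarrow>\<^sub>M gr_obj B k X" and x: "x \<in> space W"
  shows "gr_comp B k 0 X \<kappa> (gr_unit B X) x = \<kappa> x"
proof (rule measure_eq_nn_integralI)
  show "sets (gr_comp B k 0 X \<kappa> (gr_unit B X) x) = sets (gr_space B k X)"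
    using measurable_gr_kernel_sets[OF measurable_gr_comp[OF B \<kappa> measurable_gr_unit] x] by simp
  show s: "sets (\<kappa> x) = sets (gr_space B k X)"
    by (rule measurable_gr_kernel_sets[OF \<kappa> x])
  fix f :: "_ \<Rightarrow> ennreal" assume f: "f \<in> borel_measurable (gr_space B k X)"
  then have f': "f \<in> borel_measurable (gr_space B (k + 0) X)" by simp
  have "(\<integral>\<^sup>+ p. f p \<partial>gr_comp B k 0 X \<kappa> (gr_unit B X) x) =
      (\<integral>\<^sup>+ (b, z). (\<integral>\<^sup>+ (c, z'). f (b @ c, z') \<partial>gr_unit B X z) \<partial>\<kappa> x)"
    by (rule nn_integral_gr_comp[OF B \<kappa> x measurable_gr_unit f'])
  also have "\<dots> = (\<integral>\<^sup>+ p. f p \<partial>\<kappa> x)"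
  proof (rule nn_integral_cong)
    fix q assume "q \<in> space (\<kappa> x)"
    then obtain b z where q: "q = (b, z)" "length b = k" "set b \<subseteq> B" "z \<in> space X"
      using sets_eq_imp_space_eq[OF s] by (auto simp: space_gr_space)
    have "(\<lambda>(c, z'). f (b @ c, z')) \<in> borel_measurable (gr_space B 0 X)"
      using measurable_compose[OF measurable_gr_append[OF q(2,3)] f'] by (simp add: case_prod_beta')
    then show "(case q of (b, z) \<Rightarrow> \<integral>\<^sup>+ (c, z'). f (b @ c, z') \<partial>gr_unit B X z) = f q"
      unfolding gr_unit_def q(1) prod.case
      by (subst nn_integral_return) (simp_all add: space_gr_space q)
  qed
  finally show "(\<integral>\<^sup>+ p. f p \<partial>gr_comp B k 0 X \<kappa> (gr_unit B X) x) = (\<integral>\<^sup>+ p. f p \<partial>\<kappa> x)" .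
qed

text \<open>Naturality of composition. The kernel \<open>\<xi>'\<close> has to lift
  \<open>\<kappa>'\<close> along \<open>h\<close> at every point, while \<open>\<xi>\<close> and
  \<open>\<kappa>\<close> are compared at the single points \<open>y\<close> and \<open>x\<close>.
  Thus the first stage can start on the quotient (\<open>V = Y\<close>) or on the original states;
  both uses occur below.\<close>

lemma gr_map_gr_comp:
  assumes B: "finite B" and h: "h \<in> X \<rightarrow>\<^sub>M Y"
    and \<kappa>: "\<kappa> \<in> W \<rightarrow>\<^sub>M gr_obj B j X" and x: "x \<in> space W" and \<kappa>': "\<kappa>' \<in> X \<rightarrow>\<^sub>M gr_obj B k X"
    and \<xi>: "\<xi> \<in> V \<rightarrow>\<^sub>M gr_obj B j Y" and y: "y \<in> space V" and \<xi>y: "\<xi> y = gr_map B j Y h (\<kappa> x)" and \<xi>': "\<xi>' \<in> Y \<rightarrow>\<^sub>M gr_obj B k Y"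
    and eq: "\<And>z. z \<in> space X \<Longrightarrow> \<xi>' (h z) = gr_map B k Y h (\<kappa>' z)"
  shows "gr_map B (j + k) Y h (gr_comp B j k X \<kappa> \<kappa>' x) = gr_comp B j k Y \<xi> \<xi>' y" (is "?L = ?R")
proof (rule measure_eq_nn_integralI)
  note c = measurable_gr_comp[OF B \<kappa> \<kappa>']
  show "sets ?L = sets (gr_space B (j + k) Y)"
    by (simp add: gr_map_def)
  show "sets ?R = sets (gr_space B (j + k) Y)"
    by (rule measurable_gr_kernel_sets[OF measurable_gr_comp[OF B \<xi> \<xi>'] y])
  fix f :: "_ \<Rightarrow> ennreal" assume f: "f \<in> borel_measurable (gr_space B (j + k) Y)"
  have fh: "(\<lambda>(b, z). f (b, h z)) \<in> borel_measurable (gr_space B (j + k) X)"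
    using measurable_compose[OF measurable_gr_mapfun[OF h] f] by (simp add: case_prod_beta')
  have "(\<integral>\<^sup>+ p. f p \<partial>?L) = (\<integral>\<^sup>+ (b, z). f (b, h z) \<partial>gr_comp B j k X \<kappa> \<kappa>' x)"
    by (rule nn_integral_gr_map[OF h measurable_gr_kernel_sets[OF c x] f])
  also have "\<dots> = (\<integral>\<^sup>+ (b, z). (\<integral>\<^sup>+ (c, z'). f (b @ c, h z') \<partial>\<kappa>' z) \<partial>\<kappa> x)"
    by (subst nn_integral_gr_comp[OF B \<kappa> x \<kappa>' fh]) simp
  also have "\<dots> = (\<integral>\<^sup>+ (b, z). (\<integral>\<^sup>+ (c, z'). f (b @ c, z') \<partial>\<xi>' (h z)) \<partial>\<kappa> x)"
  proof (rule nn_integral_cong)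
    fix q assume "q \<in> space (\<kappa> x)"
    then obtain b z where q: "q = (b, z)" "length b = j" "set b \<subseteq> B" "z \<in> space X"
      using sets_eq_imp_space_eq[OF measurable_gr_kernel_sets[OF \<kappa> x]] by (auto simp: space_gr_space)
    have "(\<lambda>(c, z'). f (b @ c, z')) \<in> borel_measurable (gr_space B k Y)"
      using measurable_compose[OF measurable_gr_append[OF q(2,3)] f] by (simp add: case_prod_beta')
    from nn_integral_gr_map[OF h measurable_gr_kernel_sets[OF \<kappa>' q(4)] this]
    show "(case q of (b, z) \<Rightarrow> \<integral>\<^sup>+ (c, z'). f (b @ c, h z') \<partial>\<kappa>' z) =
        (case q of (b, z) \<Rightarrow> \<integral>\<^sup>+ (c, z'). f (b @ c, z') \<partial>\<xi>' (h z))"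
      by (simp add: q(1) eq[OF q(4)])
  qed
  also have "\<dots> = (\<integral>\<^sup>+ (b, y). (\<integral>\<^sup>+ (c, z'). f (b @ c, z') \<partial>\<xi>' y) \<partial>\<xi> y)"
    unfolding \<xi>y
    by (subst nn_integral_gr_map[OF h measurable_gr_kernel_sets[OF \<kappa> x] measurable_gr_integral[OF B \<xi>' f]]) simp
  also have "\<dots> = (\<integral>\<^sup>+ p. f p \<partial>?R)"
    by (rule nn_integral_gr_comp[OF B \<xi> y \<xi>' f, symmetric])
  finally show "(\<integral>\<^sup>+ p. f p \<partial>?L) = (\<integral>\<^sup>+ p. f p \<partial>?R)" .
qed

section \<open>The sampled process is a graded coalgebra\<close>

lemma samp_count_Nil: "samp_count [] = 0"
  and samp_count_Cons: "samp_count (p # u) = snd p + samp_count u"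
  and samp_count_append: "samp_count (u @ v) = samp_count u + samp_count v"
  and samp_count_rev: "samp_count (rev u) = samp_count u"
  by (simp_all add: samp_count_def case_prod_beta' flip: rev_map)

lemma Samp_nonneg: "w \<in> Samp \<Longrightarrow> p \<in> set w \<Longrightarrow> 0 \<le> fst p"
  by (auto simp: Samp_def in_set_conv_nth)

context feller_dynkin
begin

section \<open>One-step kernels and the merging of adjacent steps\<close>

abbreviation "step \<equiv> sample_step (Pow AP) \<gamma> obs"
abbreviation "run \<equiv> sampled_rev (Pow AP) \<gamma> obs"

lemma finite_Pow_AP: "finite (Pow AP)"
  using finite_AP by simp

text \<open>Taking \<open>q\<close> to be the identity gives the sampled step; taking it to be a
  quotient map gives the image of that step on the quotient.\<close>

lemma measurable_record:
  assumes "q \<in> borel \<rightarrow>\<^sub>M Y"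
  shows "(\<lambda>z. (replicate k (obs z), q z)) \<in> borel \<rightarrow>\<^sub>M gr_space (Pow AP) k Y"
proof -
  have "replicate k \<in> count_space (Pow AP) \<rightarrow>\<^sub>M
      count_space {bs. length bs = k \<and> set bs \<subseteq> Pow AP}"
    by (auto simp: set_replicate_conv_if)
  from measurable_compose[OF obs_measurable this] show ?thesis
    unfolding gr_space_def using assms by (rule measurable_Pair)
qed

lemma sets_kernel_borel: "0 \<le> t \<Longrightarrow> sets (\<gamma> t x) = sets borel"
  by (rule sets_kernel[OF kernel]) auto

lemma measurable_record_kernel:
  assumes "0 \<le> t" "q \<in> borel \<rightarrow>\<^sub>M Y"
  shows "(\<lambda>z. (replicate k (obs z), q z)) \<in> \<gamma> t x \<rightarrow>\<^sub>M gr_space (Pow AP) k Y"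
  using measurable_record[OF assms(2)]
    measurable_cong_sets[OF sets_kernel_borel[OF assms(1)] refl] by blast

lemma measurable_step:
  assumes "0 \<le> fst p"
  shows "step p \<in> borel \<rightarrow>\<^sub>M gr_obj (Pow AP) (snd p) borel"
  using measurable_compose[OF kernel[OF assms] measurable_distr[OF measurable_record[of "\<lambda>z. z" borel "snd p"]]]
  by (simp add: sample_step_def gr_obj_def case_prod_beta')

lemma nn_integral_step:
  assumes "0 \<le> t" "f \<in> borel_measurable (gr_space (Pow AP) k borel)"
  shows "(\<integral>\<^sup>+ p. f p \<partial>step (t, k) x) = (\<integral>\<^sup>+ z. f (replicate k (obs z), z) \<partial>\<gamma> t x)"
  using measurable_record_kernel[OF assms(1), of "\<lambda>z. z"] assms(2)
  by (simp add: sample_step_def nn_integral_distr)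

text \<open>The equation for sets identifies \<open>\<gamma> (s + t) x\<close> with the bind of
  \<open>\<gamma> s x\<close> and \<open>\<gamma> t\<close>, and integration over a bind is
  iterated.\<close>

lemma nn_integral_chapman_kolmogorov:
  assumes "0 \<le> s" "0 \<le> t" and f: "f \<in> borel_measurable borel"
  shows "(\<integral>\<^sup>+ z. f z \<partial>\<gamma> (s + t) x) = (\<integral>\<^sup>+ z. (\<integral>\<^sup>+ z'. f z' \<partial>\<gamma> t z) \<partial>\<gamma> s x)"
proof -
  have k: "\<gamma> t \<in> \<gamma> s x \<rightarrow>\<^sub>M subprob_algebra borel"
    using kernel[OF assms(2)] measurable_cong_sets[OF sets_kernel_borel[OF assms(1)] refl] by blast
  have sp: "space (\<gamma> s x) \<noteq> {}"
    using sets_eq_imp_space_eq[OF sets_kernel_borel[OF assms(1)]] by simp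
  have "\<gamma> (s + t) x = \<gamma> s x \<bind> \<gamma> t"
  proof (rule measure_eqI)
    show "sets (\<gamma> (s + t) x) = sets (\<gamma> s x \<bind> \<gamma> t)"
      using assms(1,2) sets_bind_measurable[OF k sp] by (simp add: sets_kernel_borel)
    fix C assume "C \<in> sets (\<gamma> (s + t) x)"
    then have "C \<in> sets borel"
      using assms(1,2) by (simp add: sets_kernel_borel)
    then show "emeasure (\<gamma> (s + t) x) C = emeasure (\<gamma> s x \<bind> \<gamma> t) C"
      using chapman_kolmogorov[OF assms(1,2)] emeasure_bind[OF sp k] by simp
  qed
  then show ?thesis
    using nn_integral_bind[OF f k] by simp
qed

text \<open>These are the two reductions of the free product at a junction. If \<open>j = 0\<close>,
  the first step records nothing and Chapman-Kolmogorov applies. If \<open>t = 0\<close>, the second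
  step stays put, so both blocks record the same state.\<close>

lemma step_merge:
  assumes "0 \<le> s" "0 \<le> t" "j = 0 \<or> t = 0"
  shows "step (s + t, j + k) = gr_comp (Pow AP) j k borel (step (s, j)) (step (t, k))"
    (is "?L = ?R")
proof
  fix x :: 'a
  note m = measurable_step[of "(s, j)", simplified, OF assms(1)]
    measurable_step[of "(t, k)", simplified, OF assms(2)]
  have x: "x \<in> space borel" by simp
  show "?L x = ?R x"
  proof (rule measure_eq_nn_integralI)
    show "sets (?L x) = sets (gr_space (Pow AP) (j + k) borel)"
      by (simp add: sample_step_def)
    show "sets (?R x) = sets (gr_space (Pow AP) (j + k) borel)"
      by (rule measurable_gr_kernel_sets[OF measurable_gr_comp[OF finite_Pow_AP m] x])
    fix f :: "'p set list \<times> 'a \<Rightarrow> ennreal"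
    assume f: "f \<in> borel_measurable (gr_space (Pow AP) (j + k) borel)"
    have F: "(\<lambda>z. f (replicate (j + k) (obs z), z)) \<in> borel_measurable borel"
      using measurable_compose[OF measurable_record f, of "\<lambda>z. z"] by simp
    have "(\<integral>\<^sup>+ p. f p \<partial>?R x) =
        (\<integral>\<^sup>+ (b, z). (\<integral>\<^sup>+ (c, z'). f (b @ c, z') \<partial>step (t, k) z) \<partial>step (s, j) x)"
      by (rule nn_integral_gr_comp[OF finite_Pow_AP m(1) x m(2) f])
    also have "\<dots> = (\<integral>\<^sup>+ z. (\<integral>\<^sup>+ (c, z'). f (replicate j (obs z) @ c, z') \<partial>step (t, k) z) \<partial>\<gamma> s x)"
      by (subst nn_integral_step[OF assms(1) measurable_gr_integral[OF finite_Pow_AP m(2) f]]) simp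
    also have "\<dots> = (\<integral>\<^sup>+ z. (\<integral>\<^sup>+ z'. f (replicate j (obs z) @ replicate k (obs z'), z') \<partial>\<gamma> t z) \<partial>\<gamma> s x)"
    proof (rule nn_integral_cong)
      fix z
      have "length (replicate j (obs z)) = j" "set (replicate j (obs z)) \<subseteq> Pow AP"
        using measurable_space[OF obs_measurable, of z] by (auto simp: set_replicate_conv_if)
      from measurable_compose[OF measurable_gr_append[OF this] f]
      have "(\<lambda>(c, z'). f (replicate j (obs z) @ c, z')) \<in> borel_measurable (gr_space (Pow AP) k borel)"
        by (simp add: case_prod_beta')
      from nn_integral_step[OF assms(2) this]
      show "(\<integral>\<^sup>+ (c, z'). f (replicate j (obs z) @ c, z') \<partial>step (t, k) z) =
          (\<integral>\<^sup>+ z'. f (replicate j (obs z) @ replicate k (obs z'), z') \<partial>\<gamma> t z)"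
        by simp
    qed
    \<comment> \<open>For \<open>j = 0\<close> the words agree literally. For \<open>t = 0\<close>
      the inner measure is Dirac at \<open>z\<close>, so \<open>z'\<close> is replaced by
      \<open>z\<close> and the two blocks join.\<close>
    also have "\<dots> = (\<integral>\<^sup>+ z. (\<integral>\<^sup>+ z'. f (replicate (j + k) (obs z'), z') \<partial>\<gamma> t z) \<partial>\<gamma> s x)"
      using assms(3)
    proof
      assume t: "t = 0"
      have "(\<lambda>z'. f (replicate j (obs z) @ replicate k (obs z'), z')) \<in> borel_measurable borel" for z
      proof -
        have "length (replicate j (obs z)) = j" "set (replicate j (obs z)) \<subseteq> Pow AP"
          using measurable_space[OF obs_measurable, of z] by (auto simp: set_replicate_conv_if)
        from measurable_compose[OF measurable_compose[OF measurable_record measurable_gr_append[OF this]] f]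
        show ?thesis by simp
      qed
      then show ?thesis
        using F by (simp add: t kernel_zero nn_integral_return replicate_add)
    qed simp
    also have "\<dots> = (\<integral>\<^sup>+ z. f (replicate (j + k) (obs z), z) \<partial>\<gamma> (s + t) x)"
      by (rule nn_integral_chapman_kolmogorov[OF assms(1,2) F, symmetric])
    also have "\<dots> = (\<integral>\<^sup>+ p. f p \<partial>?L x)"
      using assms(1,2) by (intro nn_integral_step[OF _ f, symmetric]) simp
    finally show "(\<integral>\<^sup>+ p. f p \<partial>?L x) = (\<integral>\<^sup>+ p. f p \<partial>?R x)" ..
  qed
qed

section \<open>Runs along lists and the product of samples\<close>

lemma measurable_run:
  "\<forall>p\<in>set u. 0 \<le> fst p \<Longrightarrow> run u \<in> borel \<rightarrow>\<^sub>M gr_obj (Pow AP) (samp_count u) borel"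
proof (induction u)
  case Nil
  then show ?case by (simp add: samp_count_Nil measurable_gr_unit)
next
  case (Cons p u)
  then show ?case
    using measurable_gr_comp[OF finite_Pow_AP Cons.IH measurable_step[of p]] measurable_step[of p]
    by (auto simp: samp_count_Cons samp_count_Nil add.commute)
qed

text \<open>The empty run is the unit, so by the left unit law the case \<open>u = []\<close>
  singled out by the recursion obeys the general equation.\<close>

lemma run_Cons:
  assumes "0 \<le> fst p"
  shows "run (p # u) = gr_comp (Pow AP) (samp_count u) (snd p) borel (run u) (step p)"
proof (cases "u = []")
  case True
  show ?thesis
    by (rule ext)
      (simp add: True samp_count_Nil gr_comp_unit_left[OF finite_Pow_AP measurable_step[OF assms]])
qed simp

text \<open>Lists are stored last step first, so \<open>u\<close> runs before \<open>v\<close>.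
  Induction on \<open>v\<close> has the right unit law as base and associativity as step.\<close>

lemma run_append:
  assumes "\<forall>p\<in>set u. 0 \<le> fst p" "\<forall>p\<in>set v. 0 \<le> fst p"
  shows "run (v @ u) = gr_comp (Pow AP) (samp_count u) (samp_count v) borel (run u) (run v)"
  using assms(2)
proof (induction v)
  case Nil
  show ?case
    by (rule ext)
      (simp add: samp_count_Nil gr_comp_unit_right[OF finite_Pow_AP measurable_run[OF assms(1)]])
next
  case (Cons p v)
  then have p: "0 \<le> fst p" and v: "\<forall>p\<in>set v. 0 \<le> fst p"
    by auto
  show ?case
  proof
    fix x
    show "run ((p # v) @ u) x =
        gr_comp (Pow AP) (samp_count u) (samp_count (p # v)) borel (run u) (run (p # v)) x"
      using gr_comp_assoc[OF finite_Pow_AP measurable_run[OF assms(1)] _ measurable_run[OF v]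
          measurable_step[OF p], of x]
      by (simp only: append_Cons run_Cons[OF p] Cons.IH[OF v] samp_count_append samp_count_Cons
          space_borel UNIV_I add.commute simp_thms)
  qed
qed

text \<open>By \<open>run_append\<close> a run is the composite of the runs of its blocks, so a
  block enters only through its kernel and its grade. The grade matters because it is an argument of
  \<open>gr_comp\<close>.\<close>

lemma run_replace:
  assumes "\<forall>p\<in>set a \<union> set u \<union> set v \<union> set b. 0 \<le> fst p"
    and "run u = run v" "samp_count u = samp_count v"
  shows "run (a @ u @ b) = run (a @ v @ b)"
proof -
  have "run (a @ w @ b) = gr_comp (Pow AP) (samp_count b + samp_count w) (samp_count a) borel
      (gr_comp (Pow AP) (samp_count b) (samp_count w) borel (run b) (run w)) (run a)"
    if "w \<in> {u, v}" for w
  proof -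
    have "\<forall>p\<in>set a. 0 \<le> fst p" "\<forall>p\<in>set b. 0 \<le> fst p" "\<forall>p\<in>set w. 0 \<le> fst p"
      using that assms(1) by auto
    then show ?thesis
      using run_append[of "w @ b" a] run_append[of b w]
      by (simp add: ball_Un samp_count_append add.commute)
  qed
  with assms(2,3) show ?thesis by simp
qed

text \<open>\<open>samp_mult\<close> is concatenation with at most one reduction at the junction;
  \<open>step_merge\<close> justifies that reduction and \<open>run_replace\<close> carries it into
  context.\<close>

lemma run_samp_mult:
  assumes "v \<in> Samp" "w \<in> Samp"
  shows "run (rev (samp_mult v w)) = run (rev w @ rev v)"
proof -
  obtain u s j where v: "v = u @ [(s, j)]"
    using Samp_nonempty[OF assms(1)] by (metis rev_exhaust surj_pair)
  obtain t k r where w: "w = (t, k) # r"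
    using Samp_nonempty[OF assms(2)] by (metis list.exhaust surj_pair)
  have st: "0 \<le> s" "0 \<le> t"
    using Samp_nonneg[OF assms(1), of "(s, j)"] Samp_nonneg[OF assms(2), of "(t, k)"]
    by (simp_all add: v w)
  show ?thesis
  proof (cases "j = 0 \<or> t = 0")
    case True
    have "run (rev r @ [(s + t, j + k)] @ rev u) = run (rev r @ [(t, k), (s, j)] @ rev u)"
    proof (rule run_replace)
      show "\<forall>p\<in>set (rev r) \<union> set [(s + t, j + k)] \<union> set [(t, k), (s, j)] \<union> set (rev u). 0 \<le> fst p"
        using st Samp_nonneg[OF assms(1)] Samp_nonneg[OF assms(2)] by (auto simp: v w)
      show "run [(s + t, j + k)] = run [(t, k), (s, j)]"
        using step_merge[OF st True] by (simp add: samp_count_Cons samp_count_Nil)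
      show "samp_count [(s + t, j + k)] = samp_count [(t, k), (s, j)]"
        by (simp add: samp_count_Cons samp_count_Nil)
    qed
    with True show ?thesis
      by (simp add: v w samp_mult_snoc_Cons)
  next
    case False
    then show ?thesis
      by (simp add: v w samp_mult_snoc_Cons)
  qed
qed

text \<open>By \<open>run_samp_mult\<close> the multiplication law reduces to
  \<open>run_append\<close> on reversed samples. The unit law holds because
  \<open>\<gamma> 0 x\<close> is Dirac and zero observations are recorded.\<close>

lemma graded_coalgebra_sampled:
  "graded_coalgebra (Pow AP) borel (sampled_coalgebra (Pow AP) \<gamma> obs)"
  unfolding graded_coalgebra_def sampled_coalgebra_def
proof (intro conjI ballI)
  fix w assume "w \<in> Samp"
  then have "\<forall>p\<in>set (rev w). 0 \<le> fst p"
    using Samp_nonneg by auto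
  from measurable_run[OF this]
  show "run (rev w) \<in> borel \<rightarrow>\<^sub>M gr_obj (Pow AP) (samp_count w) borel"
    by (simp add: samp_count_rev)
next
  fix x :: 'a
  show "run (rev samp_one) x = gr_unit (Pow AP) borel x"
    using measurable_record[of "\<lambda>z. z" borel 0]
    by (simp add: samp_one_def sample_step_def kernel_zero gr_unit_def distr_return)
next
  fix v w and x :: 'a assume vw: "v \<in> Samp" "w \<in> Samp"
  show "run (rev (samp_mult v w)) x =
      gr_comp (Pow AP) (samp_count v) (samp_count w) borel (run (rev v)) (run (rev w)) x"
    using Samp_nonneg[OF vw(1)] Samp_nonneg[OF vw(2)]
    by (simp add: run_samp_mult[OF vw] run_append samp_count_rev)
qed

end


section \<open>Quotients of graded coalgebras\<close>

text \<open>The final sigma-algebra, the largest one making \<open>q\<close> measurable. The points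
  are restricted to the image so that every point has a representative.\<close>

definition quotient_space :: "('x \<Rightarrow> 'y) \<Rightarrow> 'x measure \<Rightarrow> 'y measure" where
  "quotient_space q X =
     sigma (q ` space X) {C. C \<subseteq> q ` space X \<and> q -` C \<inter> space X \<in> sets X}"

lemma space_quotient_space: "space (quotient_space q X) = q ` space X"
  unfolding quotient_space_def by (rule space_measure_of) blast

lemma measurable_quotient_map: "q \<in> X \<rightarrow>\<^sub>M quotient_space q X"
  unfolding quotient_space_def by (rule measurable_measure_of) auto

text \<open>Universal property of the final sigma-algebra: the \<open>g\<close>-preimage of
  \<open>A\<close> pulls back along \<open>q\<close> to the \<open>f\<close>-preimage of
  \<open>A\<close>, which is measurable.\<close>

lemma measurable_from_quotient_space:
  assumes f: "f \<in> X \<rightarrow>\<^sub>M N" and eq: "\<And>x. x \<in> space X \<Longrightarrow> g (q x) = f x"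
  shows "g \<in> quotient_space q X \<rightarrow>\<^sub>M N"
proof (rule measurableI)
  show "g y \<in> space N" if "y \<in> space (quotient_space q X)" for y
    using that measurable_space[OF f] by (auto simp: space_quotient_space eq)
  fix A assume A: "A \<in> sets N"
  let ?C = "g -` A \<inter> space (quotient_space q X)"
  have "q -` ?C \<inter> space X = f -` A \<inter> space X"
    by (auto simp: space_quotient_space simp flip: eq)
  then have "?C \<in> {C. C \<subseteq> q ` space X \<and> q -` C \<inter> space X \<in> sets X}"
    using measurable_sets[OF f A] by (auto simp: space_quotient_space)
  then show "?C \<in> sets (quotient_space q X)"
    unfolding quotient_space_def by (subst sets_measure_of) (blast, rule sigma_sets.Basic)
qed

lemma gr_map_gr_unit:
  assumes "h \<in> X \<rightarrow>\<^sub>M Y" "x \<in> space X"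
  shows "gr_map B 0 Y h (gr_unit B X x) = gr_unit B Y (h x)"
  unfolding gr_map_def gr_unit_def
  using distr_return[OF measurable_gr_mapfun[OF assms(1)], of "([], x)" B 0] assms(2)
  by (simp add: space_gr_space)

text \<open>As \<open>q\<close> is onto, every law can be checked at points \<open>q x\<close>,
  where \<open>\<zeta>\<close> is the push-forward of \<open>\<xi>\<close>. The laws then transfer
  by \<open>gr_map_gr_unit\<close> and \<open>gr_map_gr_comp\<close>.\<close>

lemma coalgebra_hom_quotient:
  fixes q :: "'x \<Rightarrow> 'y" and X :: "'x measure"
  defines "Y \<equiv> quotient_space q X"
  assumes B: "finite B" and X: "graded_coalgebra B X \<xi>"
    and descends: "\<And>w x x'. w \<in> Samp \<Longrightarrow> x \<in> space X \<Longrightarrow> x' \<in> space X \<Longrightarrow> q x = q x' \<Longrightarrow>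
      gr_map B (samp_count w) Y q (\<xi> w x) = gr_map B (samp_count w) Y q (\<xi> w x')"
  shows "\<exists>\<zeta>. coalgebra_hom B X \<xi> Y \<zeta> q"
proof -
  \<comment> \<open>\<open>inv_into\<close> picks some representative; \<open>descends\<close> makes
    the value independent of the choice.\<close>
  define \<zeta> where "\<zeta> w y = gr_map B (samp_count w) Y q (\<xi> w (inv_into (space X) q y))" for w y
  have q: "q \<in> X \<rightarrow>\<^sub>M Y"
    unfolding Y_def by (rule measurable_quotient_map)
  have \<xi>: "\<xi> w \<in> X \<rightarrow>\<^sub>M gr_obj B (samp_count w) X" if "w \<in> Samp" for w
    using X that by (simp add: graded_coalgebra_def)
  have \<zeta>q: "\<zeta> w (q x) = gr_map B (samp_count w) Y q (\<xi> w x)" if "w \<in> Samp" "x \<in> space X" for w x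
    unfolding \<zeta>_def using that by (intro descends) (auto intro: inv_into_into f_inv_into_f)
  have \<zeta>: "\<zeta> w \<in> Y \<rightarrow>\<^sub>M gr_obj B (samp_count w) Y" if "w \<in> Samp" for w
    by (rule measurable_from_quotient_space[where q = q and X = X, folded Y_def,
          OF measurable_compose[OF \<xi>[OF that] measurable_gr_map[OF q]]])
      (rule \<zeta>q[OF that])
  have Yq: "\<exists>x\<in>space X. y = q x" if "y \<in> space Y" for y
    using that by (auto simp: Y_def space_quotient_space)
  have "graded_coalgebra B Y \<zeta>"
    unfolding graded_coalgebra_def
  proof (intro conjI ballI \<zeta>)
    fix y assume "y \<in> space Y"
    then obtain x where x: "x \<in> space X" "y = q x" using Yq by blast
    show "\<zeta> samp_one y = gr_unit B Y y"
      using X x \<zeta>q[OF samp_one_in_Samp x(1)] gr_map_gr_unit[OF q x(1), of B]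
      by (simp add: graded_coalgebra_def) (simp add: samp_count_def samp_one_def)
  next
    fix v w y assume vw: "v \<in> Samp" "w \<in> Samp" and "y \<in> space Y"
    then obtain x where x: "x \<in> space X" "y = q x" using Yq by blast
    have "\<zeta> (samp_mult v w) y = gr_map B (samp_count v + samp_count w) Y q (\<xi> (samp_mult v w) x)"
      using \<zeta>q[OF samp_mult_closed[OF vw] x(1)] by (simp add: x(2) samp_count_mult[OF vw])
    also have "\<xi> (samp_mult v w) x = gr_comp B (samp_count v) (samp_count w) X (\<xi> v) (\<xi> w) x"
      using X vw x(1) by (simp add: graded_coalgebra_def)
    also have "gr_map B (samp_count v + samp_count w) Y q \<dots> =
        gr_comp B (samp_count v) (samp_count w) Y (\<zeta> v) (\<zeta> w) y"
      using measurable_space[OF q x(1)] vw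
      by (intro gr_map_gr_comp[OF B q \<xi> x(1) \<xi> \<zeta> _ _ \<zeta>]) (simp_all add: x(2) \<zeta>q x(1))
    finally show "\<zeta> (samp_mult v w) y = gr_comp B (samp_count v) (samp_count w) Y (\<zeta> v) (\<zeta> w) y" .
  qed
  then have "coalgebra_hom B X \<xi> Y \<zeta> q"
    using X q \<zeta>q by (simp add: coalgebra_hom_def)
  then show ?thesis by (intro exI[of _ \<zeta>])
qed


section \<open>Bisimilar states have equal transition probabilities\<close>

lemma space_cemetery_space: "space cemetery_space = UNIV"
  by (simp add: cemetery_space_def)

lemma sets_cemetery_kernel: "sets (cemetery_kernel \<gamma> t (Some x)) = sets cemetery_space"
  using sets.sigma_sets_eq[of cemetery_space]
  by (simp add: cemetery_kernel_def space_cemetery_space)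

lemma Some_image_cemetery: "C \<in> sets borel \<Longrightarrow> Some ` C \<in> sets cemetery_space"
  by (auto simp: sets_cemetery_space)

lemma space_path_space: "space path_space = trajectories"
  by (auto simp: path_space_def space_restrict_space space_PiM space_cemetery_space trajectories_def)

lemma sets_path_space_evaluation:
  assumes "0 \<le> t" "C \<in> sets cemetery_space"
  shows "{\<omega> \<in> trajectories. \<omega> t \<in> C} \<in> sets path_space"
proof -
  have "(\<lambda>\<omega>. \<omega> t) \<in> path_space \<rightarrow>\<^sub>M cemetery_space"
    unfolding path_space_def
    using assms(1) by (intro measurable_restrict_space1 measurable_component_singleton) simp
  from measurable_sets[OF this assms(2)] show ?thesis
    by (simp add: space_path_space vimage_def Int_def conj_commute)
qed

text \<open>A list with one entry gives a one-time distribution. The image of \<open>C\<close> under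
  \<open>Some\<close> omits the cemetery, so the missing mass sent to \<open>None\<close>
  contributes nothing.\<close>

lemma (in feller_dynkin) emeasure_path_law_evaluation:
  assumes "path_law \<gamma> x P" "0 \<le> t" "C \<in> sets borel"
  shows "emeasure P {\<omega> \<in> trajectories. \<omega> t \<in> Some ` C} = emeasure (\<gamma> t x) C"
proof -
  note C = Some_image_cemetery[OF assms(3)]
  have "(\<forall>(s, D)\<in>set L. 0 \<le> s \<and> D \<in> sets cemetery_space) \<longrightarrow>
      emeasure P {\<omega> \<in> trajectories. \<forall>i<length L. \<omega> (\<Sum>j\<le>i. fst (L ! j)) \<in> snd (L ! i)} =
      fdd \<gamma> (Some x) L" for L
    using assms(1) unfolding path_law_def by (elim conjE) (erule spec)
  from this[of "[(t, Some ` C)]"]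
  have "emeasure P {\<omega> \<in> trajectories. \<omega> t \<in> Some ` C} = fdd \<gamma> (Some x) [(t, Some ` C)]"
    using assms(2) C by simp
  moreover have "fdd \<gamma> (Some x) [(t, Some ` C)] = emeasure (\<gamma> t x) C"
    using C by (simp add: sets_cemetery_kernel emeasure_cemetery_kernel[of \<gamma> t x, OF sets_kernel_borel[OF assms(2)] C]
        inj_vimage_image_eq)
  ultimately show ?thesis by simp
qed

lemma (in feller_dynkin) bisimulation_kernel_eq:
  assumes P: "\<And>z. path_law \<gamma> z (P z)" and R: "bisimulation obs P R" "(x, y) \<in> R"
    and t: "0 \<le> t" and C: "C \<in> sets borel" "\<And>a b. (a, b) \<in> R \<Longrightarrow> a \<in> C \<Longrightarrow> b \<in> C"
  shows "emeasure (\<gamma> t x) C = emeasure (\<gamma> t y) C"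
proof -
  let ?U = "{\<omega> \<in> trajectories. \<omega> t \<in> Some ` C}"
  have "?U \<in> sets path_space"
    by (rule sets_path_space_evaluation[OF t Some_image_cemetery[OF C(1)]])
  moreover have "time_closed R ?U"
    unfolding time_closed_def
  proof (intro ballI impI)
    fix \<omega> \<omega>' assume "\<omega> \<in> ?U" "\<omega>' \<in> trajectories"
      and rel: "\<forall>t\<ge>0. rel_option (\<lambda>a b. (a, b) \<in> R) (\<omega> t) (\<omega>' t)"
    then obtain a where a: "a \<in> C" "\<omega> t = Some a" by blast
    \<comment> \<open>\<open>rel_option\<close> relates a state only to a state, so
      \<open>\<omega>'\<close> has not reached the cemetery at time \<open>t\<close>.\<close>
    then obtain b where "\<omega>' t = Some b" "(a, b) \<in> R"
      using rel t by (metis option_rel_Some1)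
    with a C(2) \<open>\<omega>' \<in> trajectories\<close> show "\<omega>' \<in> ?U" by blast
  qed
  ultimately have "emeasure (P x) ?U = emeasure (P y) ?U"
    using R unfolding bisimulation_def by blast
  then show ?thesis
    by (simp add: emeasure_path_law_evaluation[OF P t C(1)])
qed

text \<open>The induction peels off the last step, which comes first in the list. That step becomes
  a kernel on the quotient, and the earlier part has the same image from \<open>x\<close> and from
  \<open>y\<close> by induction.\<close>

lemma (in feller_dynkin) run_descends:
  fixes q :: "'a \<Rightarrow> 'y"
  defines "Y \<equiv> quotient_space q borel"
  assumes obs: "\<And>x y. q x = q y \<Longrightarrow> obs x = obs y"
    and \<gamma>: "\<And>t x y C. 0 \<le> t \<Longrightarrow> q x = q y \<Longrightarrow> C \<in> sets borel \<Longrightarrow>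
      (\<And>a b. q a = q b \<Longrightarrow> a \<in> C \<Longrightarrow> b \<in> C) \<Longrightarrow> emeasure (\<gamma> t x) C = emeasure (\<gamma> t y) C"
    and u: "\<forall>p\<in>set u. 0 \<le> fst p" and xy: "q x = q y"
  shows "gr_map (Pow AP) (samp_count u) Y q (run u x) = gr_map (Pow AP) (samp_count u) Y q (run u y)"
proof -
  have q: "q \<in> borel \<rightarrow>\<^sub>M Y"
    unfolding Y_def by (rule measurable_quotient_map)
  show ?thesis
    using u
  proof (induction u)
    case Nil
    show ?case
      by (simp add: samp_count_Nil gr_map_gr_unit[OF q] xy)
  next
    case (Cons p u)
    then have p: "0 \<le> fst p" and u: "\<forall>p\<in>set u. 0 \<le> fst p" by auto
    \<comment> \<open>Needed for all pairs in a common fibre of \<open>q\<close>, since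
      \<open>\<xi>'\<close> must be well defined on every class; the induction hypothesis concerns
      the fixed \<open>x\<close> and \<open>y\<close>.\<close>
    have step: "gr_map (Pow AP) (snd p) Y q (step p x) = gr_map (Pow AP) (snd p) Y q (step p y)"
      if xy: "q x = q y" for x y
    proof -
      have eq: "gr_map (Pow AP) (snd p) Y q (step p x) =
          distr (\<gamma> (fst p) x) (gr_space (Pow AP) (snd p) Y) (\<lambda>z. (replicate (snd p) (obs z), q z))" for x
        using distr_distr[OF measurable_gr_mapfun[OF q] measurable_record_kernel[OF p, of "\<lambda>z. z"]]
        by (simp add: gr_map_def sample_step_def case_prod_beta' comp_def)
      show ?thesis
        unfolding eq
      proof (rule measure_eqI)
        fix S assume "S \<in> sets (distr (\<gamma> (fst p) x) (gr_space (Pow AP) (snd p) Y)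
          (\<lambda>z. (replicate (snd p) (obs z), q z)))"
        then have S: "S \<in> sets (gr_space (Pow AP) (snd p) Y)" by simp
        \<comment> \<open>\<open>obs\<close> and \<open>q\<close> are constant on the fibres of
          \<open>q\<close>, so this preimage is saturated and the hypothesis on the kernels
          applies.\<close>
        let ?C = "(\<lambda>z. (replicate (snd p) (obs z), q z)) -` S"
        have "?C \<in> sets borel"
          using measurable_sets[OF measurable_record[OF q] S] by simp
        moreover have "b \<in> ?C" if "q a = q b" "a \<in> ?C" for a b
          using that obs[OF that(1)] by simp
        ultimately have "emeasure (\<gamma> (fst p) x) ?C = emeasure (\<gamma> (fst p) y) ?C"
          by (intro \<gamma> p xy)
        then show "emeasure (distr (\<gamma> (fst p) x) (gr_space (Pow AP) (snd p) Y)
            (\<lambda>z. (replicate (snd p) (obs z), q z))) S =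
          emeasure (distr (\<gamma> (fst p) y) (gr_space (Pow AP) (snd p) Y)
            (\<lambda>z. (replicate (snd p) (obs z), q z))) S"
          using S sets_eq_imp_space_eq[OF sets_kernel_borel[OF p]]
          by (simp add: emeasure_distr measurable_record_kernel[OF p q])
      qed simp
    qed
    \<comment> \<open>\<open>\<xi>\<close> starts from the original states, whereas
      \<open>\<xi>'\<close> lives on the quotient, where \<open>step\<close> makes the
      representative chosen by \<open>inv q\<close> immaterial.\<close>
    define \<xi> where "\<xi> = (\<lambda>x. gr_map (Pow AP) (samp_count u) Y q (run u x))"
    define \<xi>' where "\<xi>' = (\<lambda>y. gr_map (Pow AP) (snd p) Y q (step p (inv q y)))"
    have \<xi>: "\<xi> \<in> borel \<rightarrow>\<^sub>M gr_obj (Pow AP) (samp_count u) Y"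
      unfolding \<xi>_def by (rule measurable_compose[OF measurable_run[OF u] measurable_gr_map[OF q]])
    have \<xi>'q: "\<xi>' (q z) = gr_map (Pow AP) (snd p) Y q (step p z)" for z
      unfolding \<xi>'_def by (intro step) (simp add: f_inv_into_f)
    have \<xi>': "\<xi>' \<in> Y \<rightarrow>\<^sub>M gr_obj (Pow AP) (snd p) Y"
      by (rule measurable_from_quotient_space[where q = q and X = borel, folded Y_def,
            OF measurable_compose[OF measurable_step[OF p] measurable_gr_map[OF q]]])
        (rule \<xi>'q)
    have eq: "gr_map (Pow AP) (samp_count (p # u)) Y q (run (p # u) x) =
        gr_comp (Pow AP) (samp_count u) (snd p) Y \<xi> \<xi>' x" for x
      unfolding run_Cons[OF p] samp_count_Cons add.commute[of "snd p"]
      by (rule gr_map_gr_comp[OF finite_Pow_AP q measurable_run[OF u] _ measurable_step[OF p] \<xi> _ _ \<xi>'])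
        (simp_all add: \<xi>_def \<xi>'q)
    \<comment> \<open>The right-hand side of \<open>eq\<close> depends on the starting state only
      through the value of \<open>\<xi>\<close> there.\<close>
    have "\<xi> x = \<xi> y"
      unfolding \<xi>_def by (rule Cons.IH[OF u])
    then show ?case
      by (simp only: eq gr_comp_def)
  qed
qed

section \<open>The quotient by a bisimulation\<close>

theorem theorem3p12:
  fixes AP :: "'p set"
    and \<gamma> :: "real \<Rightarrow> 'a::{t2_space, second_countable_topology} \<Rightarrow> 'a measure"
    and obs :: "'a \<Rightarrow> 'p set"
    and P :: "'a \<Rightarrow> (real \<Rightarrow> 'a option) measure"
    and x y :: 'a
  assumes "feller_dynkin AP \<gamma> obs"
    and "\<And>z. path_law \<gamma> z (P z)"
    and "bisimilar obs P x y"
  shows "behaviourally_equivalent (Pow AP)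
           borel (sampled_coalgebra (Pow AP) \<gamma> obs)
           borel (sampled_coalgebra (Pow AP) \<gamma> obs) x y"
proof -
  interpret feller_dynkin AP \<gamma> obs by fact
  obtain R where R: "bisimulation obs P R" "(x, y) \<in> R"
    using assms(3) by (auto simp: bisimilar_def)
  \<comment> \<open>The carrier of the cospan consists of sets over a disjoint sum, so each class is
    placed in the left copy. As \<open>Inl\<close> is injective, the fibres of \<open>q\<close> are
    the classes of \<open>R\<close>.\<close>
  define q :: "'a \<Rightarrow> ('a + 'a) set" where "q z = Inl ` (R `` {z})" for z
  have "equiv UNIV R"
    using R(1) by (simp add: bisimulation_def)
  then have q: "q a = q b \<longleftrightarrow> (a, b) \<in> R" for a b
    by (simp add: q_def inj_image_eq_iff eq_equiv_class_iff)
  have "\<exists>\<zeta>. coalgebra_hom (Pow AP) borel (sampled_coalgebra (Pow AP) \<gamma> obs) (quotient_space q borel) \<zeta> q"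
  proof (rule coalgebra_hom_quotient[OF finite_Pow_AP graded_coalgebra_sampled])
    fix w and a b :: 'a assume w: "w \<in> Samp" and ab: "q a = q b"
    have "gr_map (Pow AP) (samp_count (rev w)) (quotient_space q borel) q (run (rev w) a) =
        gr_map (Pow AP) (samp_count (rev w)) (quotient_space q borel) q (run (rev w) b)"
    proof (rule run_descends[OF _ _ _ ab])
      show "obs a = obs b" if "q a = q b" for a b
        using R(1) that by (auto simp: bisimulation_def q)
      \<comment> \<open>Saturation under \<open>q\<close> is closedness under \<open>R\<close>, so
        this is an instance of \<open>bisimulation_kernel_eq\<close>.\<close>
      show "emeasure (\<gamma> t a) C = emeasure (\<gamma> t b) C"
        if "0 \<le> t" "q a = q b" "C \<in> sets borel" "\<And>a b. q a = q b \<Longrightarrow> a \<in> C \<Longrightarrow> b \<in> C" for t a b C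
        using bisimulation_kernel_eq[OF assms(2) R(1), of a b t C] that by (simp add: q)
      show "\<forall>p\<in>set (rev w). 0 \<le> fst p"
        using Samp_nonneg[OF w] by simp
    qed
    then show "gr_map (Pow AP) (samp_count w) (quotient_space q borel) q
          (sampled_coalgebra (Pow AP) \<gamma> obs w a) =
        gr_map (Pow AP) (samp_count w) (quotient_space q borel) q
          (sampled_coalgebra (Pow AP) \<gamma> obs w b)"
      by (simp add: samp_count_rev sampled_coalgebra_def)
  qed
  moreover have "q x = q y"
    using R(2) by (simp add: q)
  \<comment> \<open>Both legs of the cospan are \<open>q\<close>.\<close>
  ultimately show ?thesis
    unfolding behaviourally_equivalent_def by auto
qed

end
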